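(* Let $G$ be an antiferromagnetic weighted graph on vertex set $[n]$ and let $t\ge2$. Then for all $\mathbf{a},\mathbf{b}\in(\mathbb{R}_{\ge0})^n$, \[ V_{K_t}(\mathbf{a},\dots,\mathbf{a};G)\cdot V_{K_t}(\mathbf{b},\dots,\mathbf{b};G)\le \sum_{\phi:[t]\times\{1,2\}\to[n]}\ \prod_{\substack{i,j\in[t]\\ i\ne j}}G(\phi(i,1),\phi(j,2))\prod_{i\in[t]}a_{\phi(i,1)}\,b_{\phi(i,2)}, \] where the right-hand side is the $G$-volume $V_{K_t\times K_2}(\mathbf{a},\dots,\mathbf{a},\mathbf{b},\dots,\mathbf{b};G)$ with $\mathbf{a}$ assigned to the vertices $(i,1)$ and $\mathbf{b}$ to the vertices $(i,2)$ of $K_t\times K_2$.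
   Context: A weighted graph $G$ on $[n]$ is a symmetric matrix with nonnegative entries $G(i,j)$ (loops allowed); it is antiferromagnetic if it has at most one positive eigenvalue, counted with multiplicity. For $\mathbf{x}\in\mathbb{R}^n$, $V_{K_t}(\mathbf{x},\dots,\mathbf{x};G)=\sum_{\phi:[t]\to[n]}\prod_{\{i,j\}\in\binom{[t]}{2}}G(\phi(i),\phi(j))\prod_{s\in[t]}x_{\phi(s)}$. The tensor product $K_t\times K_2$ has vertex set $[t]\times\{1,2\}$ with $(i,1)$ adjacent to $(j,2)$ iff $i\neq j$. *)

theory Defs
  imports "Jordan_Normal_Form.Char_Poly" "HOL-Library.FuncSet"
begin

definition weighted_graph :: "nat \<Rightarrow> real mat \<Rightarrow> bool" where
  "weighted_graph n G \<longleftrightarrow> G \<in> carrier_mat n n \<and> transpose_mat G = G \<and>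
     (\<forall>i<n. \<forall>j<n. G $$ (i,j) \<ge> 0)"

definition antiferromagnetic :: "real mat \<Rightarrow> bool" where
  "antiferromagnetic G \<longleftrightarrow>
     (\<Sum>e\<in>{e. eigenvalue G e \<and> e > 0}. order e (char_poly G)) \<le> 1"

definition V_Kt :: "nat \<Rightarrow> real mat \<Rightarrow> nat \<Rightarrow> (nat \<Rightarrow> real) \<Rightarrow> real" where
  "V_Kt n G t x = (\<Sum>\<phi>\<in>{0..<t} \<rightarrow>\<^sub>E {0..<n}.
      (\<Prod>i\<in>{0..<t}. \<Prod>j\<in>{0..<t}. if i < j then G $$ (\<phi> i, \<phi> j) else 1) *
      (\<Prod>s\<in>{0..<t}. x (\<phi> s)))"

definition V_KtK2 :: "nat \<Rightarrow> real mat \<Rightarrow> nat \<Rightarrow> (nat \<Rightarrow> real) \<Rightarrow> (nat \<Rightarrow> real) \<Rightarrow> real" where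
  "V_KtK2 n G t a b = (\<Sum>\<phi>\<in>({0..<t} \<times> {1::nat,2}) \<rightarrow>\<^sub>E {0..<n}.
      (\<Prod>i\<in>{0..<t}. \<Prod>j\<in>{0..<t}. if i \<noteq> j then G $$ (\<phi> (i,1), \<phi> (j,2)) else 1) *
      (\<Prod>i\<in>{0..<t}. a (\<phi> (i,1)) * b (\<phi> (i,2))))"

end

theory Submission
  imports Defs "HOL-Analysis.Function_Topology"
begin

text \<open>Write \<open>V\<^sub>t\<close> for the volume of \<open>K\<^sub>t\<close> as a symmetric multilinear form. Having at most one positive eigenvalue,
  \<open>G\<close> satisfies the reverse Cauchy--Schwarz inequality, and a Bochner-type induction on \<open>t\<close> extends it to the
  Alexandrov--Fenchel inequality \<open>V\<^sub>t(y,y,x,\<dots>,x) V\<^sub>t(x,\<dots>,x) \<le> V\<^sub>t(y,x,\<dots>,x)\<^sup>2\<close> for positive \<open>G\<close> and \<open>x\<close>. Hence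
  \<open>ln V\<^sub>t\<close> is concave on the positive orthant, which after scaling gives
  \<open>V\<^sub>t(a,\<dots>,a) V\<^sub>t(b,\<dots>,b) \<le> V\<^sub>t(b,a,\<dots>,a) V\<^sub>t(a,b,\<dots>,b)\<close>; a perturbation removes the positivity assumptions.
  Fixing the images \<open>k\<close>, \<open>l\<close> of the two exchanged vertices leaves two copies of \<open>K\<^sub>t\<^sub>-\<^sub>1\<close>, with the weights \<open>a\<close>, \<open>b\<close>
  multiplied by the rows \<open>l\<close>, \<open>k\<close> of \<open>G\<close>, and the theorem follows by induction on \<open>t\<close>.\<close>

section \<open>Quadratic forms\<close>

text \<open>Vectors and matrices are functions of which only the values below \<open>n\<close>
  count, so weights can be multiplied pointwise by rows of a matrix without carrier
  conditions.\<close>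

definition dot :: "nat \<Rightarrow> (nat \<Rightarrow> real) \<Rightarrow> (nat \<Rightarrow> real) \<Rightarrow> real" where
  "dot n x y = (\<Sum>i<n. x i * y i)"

definition app :: "nat \<Rightarrow> (nat \<Rightarrow> nat \<Rightarrow> real) \<Rightarrow> (nat \<Rightarrow> real) \<Rightarrow> nat \<Rightarrow> real" where
  "app n M x i = (\<Sum>j<n. M i j * x j)"

abbreviation form :: "nat \<Rightarrow> (nat \<Rightarrow> nat \<Rightarrow> real) \<Rightarrow> (nat \<Rightarrow> real) \<Rightarrow> (nat \<Rightarrow> real) \<Rightarrow> real" where
  "form n M x y \<equiv> dot n x (app n M y)"

lemma dot_commute: "dot n x y = dot n y x"
  by (simp add: dot_def mult.commute)

lemma dot_add_scale_left: "dot n (\<lambda>i. x i + s * y i) z = dot n x z + s * dot n y z"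
  by (simp add: dot_def sum.distrib sum_distrib_left algebra_simps)

lemma dot_add_scale_right: "dot n z (\<lambda>i. x i + s * y i) = dot n z x + s * dot n z y"
  by (simp add: dot_def sum.distrib sum_distrib_left algebra_simps)

lemma app_add_scale: "app n M (\<lambda>i. x i + s * y i) = (\<lambda>i. app n M x i + s * app n M y i)"
  by (simp add: app_def fun_eq_iff sum.distrib sum_distrib_left algebra_simps)

lemma form_alt: "form n M x y = (\<Sum>i<n. \<Sum>j<n. M i j * x i * y j)"
  by (simp add: dot_def app_def sum_distrib_left algebra_simps)

lemma form_commute:
  assumes "\<And>i j. i < n \<Longrightarrow> j < n \<Longrightarrow> M i j = M j i"
  shows "form n M x y = form n M y x"
  unfolding form_alt by (subst sum.swap) (auto intro!: sum.cong simp: assms)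

lemma form_add_scale:
  assumes "\<And>i j. i < n \<Longrightarrow> j < n \<Longrightarrow> M i j = M j i"
  shows "form n M (\<lambda>i. x i + s * y i) (\<lambda>i. x i + s * y i) =
    form n M x x + 2 * s * form n M x y + s\<^sup>2 * form n M y y"
  using form_commute[where x=x and y=y, OF assms]
  by (simp add: app_add_scale dot_add_scale_left dot_add_scale_right power2_eq_square algebra_simps)

text \<open>For \<open>c > 0\<close> evaluate at the vertex \<open>s = - b / c\<close>. If
  \<open>c = 0\<close> the function is affine, which forces \<open>b = 0\<close>; a negative
  \<open>c\<close> is impossible.\<close>

lemma quadratic_nonneg_discriminant:
  fixes a b c :: real
  assumes "\<And>s. 0 \<le> a + 2 * s * b + s\<^sup>2 * c"
  shows "b\<^sup>2 \<le> a * c"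
proof (cases "c = 0")
  case True
  have "b = 0"
  proof (rule ccontr)
    assume "b \<noteq> 0"
    \<comment> \<open>At this \<open>s\<close> the polynomial takes the value -1.\<close>
    then show False using assms[of "- (a + 1) / (2 * b)"] True by (simp add: field_simps)
  qed
  then show ?thesis using True by simp
next
  case False
  have "c > 0"
  proof (rule ccontr)
    assume "\<not> c > 0"
    then have c: "c < 0" using False by simp
    \<comment> \<open>Large enough that \<open>s\<^sup>2 * c\<close> outweighs the other two terms
      and the polynomial becomes negative.\<close>
    define s where "s = (\<bar>a\<bar> + 2 * \<bar>b\<bar> + 1) / (- c) + 1"
    have s: "s \<ge> 1" "s * (-c) \<ge> \<bar>a\<bar> + 2 * \<bar>b\<bar> + 1"
      using c by (auto simp: s_def field_simps)
    have "s * (s * (-c)) \<ge> s * (\<bar>a\<bar> + 2 * \<bar>b\<bar> + 1)" using s by (intro mult_left_mono) auto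
    moreover have "s * (\<bar>a\<bar> + 1) \<ge> 1 * (\<bar>a\<bar> + 1)" using s by (intro mult_right_mono) auto
    moreover have "s * b \<le> s * \<bar>b\<bar>" using s by (intro mult_left_mono) auto
    ultimately show False using assms[of s] by (simp add: power2_eq_square algebra_simps)
  qed
  then show ?thesis using assms[of "- b / c"] by (simp add: field_simps power2_eq_square)
qed

lemma form_Cauchy_Schwarz:
  assumes "\<And>i j. i < n \<Longrightarrow> j < n \<Longrightarrow> M i j = M j i" and "\<And>y. 0 \<le> form n M y y"
  shows "(form n M x y)\<^sup>2 \<le> form n M x x * form n M y y"
proof (rule quadratic_nonneg_discriminant)
  fix s
  show "0 \<le> form n M x x + 2 * s * form n M x y + s\<^sup>2 * form n M y y"
    using assms(2)[of "\<lambda>i. x i + s * y i"] form_add_scale[where x=x and y=y and s=s, OF assms(1)] by simp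
qed

text \<open>A trivial kernel makes the determinant nonzero, and the inverse matrix then supplies the
  preimage.\<close>

lemma app_surj:
  assumes inj: "\<And>y i. (\<And>i. i < n \<Longrightarrow> app n K y i = 0) \<Longrightarrow> i < n \<Longrightarrow> y i = 0"
  shows "\<exists>g. \<forall>i<n. app n K g i = f i"
proof -
  define A where "A = mat n n (\<lambda>(i,j). K i j)"
  have A: "A \<in> carrier_mat n n" by (simp add: A_def)
  have Av: "(A *\<^sub>v v) $ i = app n K (\<lambda>j. v $ j) i" if "v \<in> carrier_vec n" "i < n" for v i
    using that by (auto simp: A_def app_def scalar_prod_def atLeast0LessThan)
  have "det A \<noteq> 0"
  proof
    assume "det A = 0"
    then obtain v where v: "v \<in> carrier_vec n" "v \<noteq> 0\<^sub>v n" "A *\<^sub>v v = 0\<^sub>v n"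
      using det_0_iff_vec_prod_zero[OF A] by auto
    have "v $ i = 0" if "i < n" for i
      using inj[of "\<lambda>j. v $ j", OF _ that] Av[OF v(1)] v(3) by simp
    then have "v = 0\<^sub>v n" using v(1) by (intro eq_vecI) auto
    then show False using v(2) by simp
  qed
  from det_non_zero_imp_unit[OF A this] obtain B where
    B: "B \<in> carrier_mat n n" "A * B = 1\<^sub>m n"
    by (auto simp: Units_def ring_mat_simps)
  define v where "v = B *\<^sub>v vec n f"
  have v: "v \<in> carrier_vec n" using B by (simp add: v_def)
  have "A *\<^sub>v v = vec n f" using A B by (simp add: v_def flip: assoc_mult_mat_vec[of A n n B n])
  then have "\<forall>i<n. app n K (\<lambda>j. v $ j) i = f i" using Av[OF v] by (metis index_vec)
  then show ?thesis by blast
qed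

text \<open>In the inner product given by \<open>D\<close>, the hypothesis says \<open>A \<le> A\<^sup>2\<close> for \<open>A = D\<^sup>-\<^sup>1 M\<close>, and \<open>A x = x\<close>
  with \<open>A\<close> positive, so by Perron--Frobenius all other eigenvalues are nonpositive. Spectral theory is avoided
  by testing the hypothesis at the solution \<open>g\<close> of \<open>(D - M) g = D y\<close> and applying Cauchy--Schwarz to the
  positive semidefinite form \<open>D - M\<close>.\<close>

lemma Bochner_reverse_Cauchy_Schwarz:
  assumes sym: "\<And>i j. i < n \<Longrightarrow> j < n \<Longrightarrow> M i j = M j i"
    and pos: "\<And>i j. i < n \<Longrightarrow> j < n \<Longrightarrow> 0 < M i j"
    and x: "\<And>i. i < n \<Longrightarrow> 0 < x i"
    and bochner: "\<And>y. form n M y y \<le> (\<Sum>k<n. x k * (app n M y k)\<^sup>2 / app n M x k)"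
  shows "form n M y y * form n M x x \<le> (form n M x y)\<^sup>2"
proof (cases "n = 0")
  case True
  then show ?thesis by (simp add: dot_def)
next
  case False
  have Mx: "0 < app n M x i" if "i < n" for i
    unfolding app_def using that by (intro sum_pos) (auto intro!: mult_pos_pos pos x)
  have xMx: "0 < form n M x x"
    unfolding dot_def using False by (intro sum_pos) (auto intro!: mult_pos_pos Mx x)
  \<comment> \<open>As a diagonal matrix \<open>D\<close> satisfies \<open>D x = M x\<close>, so
    \<open>L = D - M\<close> is a graph Laplacian annihilating \<open>x\<close>.\<close>
  define D where "D i = app n M x i / x i" for i
  have D: "0 < D i" if "i < n" for i using Mx x that by (simp add: D_def)
  have Dx: "D i * x i = app n M x i" if "i < n" for i using x[OF that] by (simp add: D_def)
  define L where "L i j = (if i = j then D i else 0) - M i j" for i j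
  have Lsym: "L i j = L j i" if "i < n" "j < n" for i j using sym that by (simp add: L_def)
  have appL: "app n L y i = D i * y i - app n M y i" if "i < n" for y i
  proof -
    have "app n L y i = (\<Sum>j<n. (if i = j then D i * y i else 0) - M i j * y j)"
      unfolding app_def L_def by (intro sum.cong) (auto simp: algebra_simps)
    then show ?thesis using that by (simp add: sum_subtractf app_def)
  qed
  have Lform: "form n L z y = (\<Sum>i<n. D i * z i * y i) - form n M z y" for z y
    unfolding dot_def by (simp add: appL algebra_simps sum_subtractf)
  \<comment> \<open>This is the Dirichlet form in the variable \<open>y / x\<close>, with edge
    weights \<open>M i j * x i * x j\<close>; each pair is counted twice.\<close>
  have L_squares: "2 * form n L y y = (\<Sum>i<n. \<Sum>j<n. M i j * x i * x j * (y i / x i - y j / x j)\<^sup>2)" for y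
  proof -
    have "(\<Sum>i<n. \<Sum>j<n. M i j * x i * x j * (y i / x i - y j / x j)\<^sup>2)
      = (\<Sum>i<n. \<Sum>j<n. M i j * x j * (y i)\<^sup>2 / x i + M i j * x i * (y j)\<^sup>2 / x j - 2 * (M i j * y i * y j))"
      using x by (intro sum.cong refl) (auto simp: field_simps power2_eq_square dest!: x)
    also have "\<dots> = (\<Sum>i<n. \<Sum>j<n. M i j * x j * (y i)\<^sup>2 / x i)
        + (\<Sum>i<n. \<Sum>j<n. M i j * x i * (y j)\<^sup>2 / x j) - 2 * form n M y y"
      by (simp add: sum.distrib sum_subtractf form_alt sum_distrib_left)
    also have "(\<Sum>i<n. \<Sum>j<n. M i j * x i * (y j)\<^sup>2 / x j) = (\<Sum>i<n. \<Sum>j<n. M i j * x j * (y i)\<^sup>2 / x i)"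
      by (subst sum.swap) (auto intro!: sum.cong simp: sym)
    also have "(\<Sum>i<n. \<Sum>j<n. M i j * x j * (y i)\<^sup>2 / x i) = (\<Sum>i<n. D i * y i * y i)"
      unfolding D_def app_def
      by (simp add: sum_divide_distrib sum_distrib_left sum_distrib_right power2_eq_square algebra_simps)
    finally show ?thesis by (simp add: Lform)
  qed
  have Lpsd: "0 \<le> form n L y y" for y
  proof -
    have "0 \<le> 2 * form n L y y" unfolding L_squares
      using pos x by (intro sum_nonneg mult_nonneg_nonneg) (auto simp: less_imp_le)
    then show ?thesis by simp
  qed
  \<comment> \<open>All edge weights are positive, so vanishing squares make \<open>y / x\<close>
    constant: the kernel of \<open>L\<close> is spanned by \<open>x\<close>.\<close>
  have Lker: "y i * x j = y j * x i" if "form n L y y = 0" "i < n" "j < n" for y i j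
  proof -
    have nn: "0 \<le> M i j * x i * x j * (y i / x i - y j / x j)\<^sup>2" if "i < n" "j < n" for i j
      using pos x that by (intro mult_nonneg_nonneg) (auto simp: less_imp_le)
    have "(\<Sum>i<n. \<Sum>j<n. M i j * x i * x j * (y i / x i - y j / x j)\<^sup>2) = 0"
      using L_squares[of y] that by simp
    then have "(\<Sum>j<n. M i j * x i * x j * (y i / x i - y j / x j)\<^sup>2) = 0"
      using that nn by (subst (asm) sum_nonneg_eq_0_iff) (auto intro!: sum_nonneg)
    then have "M i j * x i * x j * (y i / x i - y j / x j)\<^sup>2 = 0"
      using that nn by (subst (asm) sum_nonneg_eq_0_iff) auto
    then have "y i / x i = y j / x j"
      using pos[OF that(2,3)] x[OF that(2)] x[OF that(3)] by simp
    then show ?thesis using x[OF that(2)] x[OF that(3)] by (simp add: field_simps)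
  qed
  define w where "w = app n M x"
  have xL: "form n L x y = 0" for y
  proof -
    have "form n L x y = (\<Sum>i<n. w i * y i) - form n M x y"
      unfolding Lform by (auto simp: Dx w_def)
    also have "(\<Sum>i<n. w i * y i) = form n M y x" by (simp add: w_def dot_def mult.commute)
    finally show ?thesis using form_commute[OF sym] by simp
  qed
  have wx: "0 < dot n w x" using xMx by (simp add: w_def dot_commute)
  \<comment> \<open>As \<open>dot n w y\<close> is the \<open>M\<close>-product of \<open>x\<close>
    and \<open>y\<close>, the claim is that \<open>M\<close> is negative semidefinite on the
    \<open>M\<close>-orthogonal complement of \<open>x\<close>.\<close>
  have orth: "form n M y y \<le> 0" if y: "dot n w y = 0" for y
  proof -
    \<comment> \<open>\<open>L\<close> is singular along \<open>x\<close>. The rank-one term makes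
      it injective because \<open>dot n w x\<close> is positive, and it will vanish at the solution
      \<open>g\<close>, which turns out to satisfy \<open>dot n w g = 0\<close>.\<close>
    define K where "K i j = L i j + w i * w j" for i j
    have appK: "app n K y i = app n L y i + w i * dot n w y" for y i
      by (simp add: K_def app_def dot_def sum.distrib sum_distrib_left algebra_simps)
    have dotK: "dot n z (app n K y) = form n L z y + dot n z w * dot n w y" for z y
      unfolding dot_def[of n z "app n K y"] appK
      by (simp add: dot_def algebra_simps sum.distrib sum_distrib_left sum_distrib_right)
    have "\<exists>g. \<forall>i<n. app n K g i = D i * y i"
    proof (rule app_surj)
      fix u i assume u: "\<And>i. i < n \<Longrightarrow> app n K u i = 0" and i: "i < n"
      have "form n K u u = 0" using u by (simp add: dot_def)
      then have "form n L u u + (dot n w u)\<^sup>2 = 0"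
        by (simp add: dotK power2_eq_square dot_commute)
      then have "form n L u u = 0" "dot n w u = 0" using Lpsd[of u] by (auto simp: add_nonneg_eq_0_iff)
      have "u i * dot n w x = (\<Sum>j<n. w j * (u i * x j))"
        by (simp add: dot_def sum_distrib_left algebra_simps)
      also have "\<dots> = (\<Sum>j<n. w j * (u j * x i))"
        using Lker[OF \<open>form n L u u = 0\<close> i] by (intro sum.cong) auto
      also have "\<dots> = x i * dot n w u"
        by (simp add: dot_def sum_distrib_left algebra_simps)
      finally show "u i = 0" using \<open>dot n w u = 0\<close> wx by simp
    qed
    then obtain g where g: "\<And>i. i < n \<Longrightarrow> app n K g i = D i * y i" by blast
    have "form n K x g = (\<Sum>i<n. w i * y i)"
      unfolding dot_def using g Dx by (auto intro!: sum.cong simp: w_def algebra_simps)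
    then have "form n K x g = 0" using y by (simp add: dot_def)
    then have "dot n x w * dot n w g = 0" using xL[of g] by (simp add: dotK)
    then have wg: "dot n w g = 0" using wx by (simp add: dot_commute)
    have Lg: "app n L g i = D i * y i" if "i < n" for i using g[OF that] appK wg by simp
    have Mg: "app n M g i = D i * (g i - y i)" if "i < n" for i
      using Lg[OF that] appL[OF that, of g] by (simp add: algebra_simps)
    \<comment> \<open>Since \<open>M g = D (g - y)\<close>, the hypothesis at \<open>g\<close>
      compares two \<open>D\<close>-weighted products with \<open>g - y\<close>; their difference
      leaves the bound \<open>test\<close>.\<close>
    have "(\<Sum>k<n. D k * g k * (g k - y k)) = form n M g g"
      unfolding dot_def by (intro sum.cong) (simp_all add: Mg)
    also have "\<dots> \<le> (\<Sum>k<n. x k * (app n M g k)\<^sup>2 / app n M x k)" by (rule bochner)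
    also have "\<dots> = (\<Sum>k<n. D k * (g k - y k) * (g k - y k))"
    proof (intro sum.cong refl)
      fix k assume "k \<in> {..<n}"
      then have k: "k < n" by simp
      have "x k / app n M x k = 1 / D k" by (simp add: D_def)
      then have "x k * (app n M g k)\<^sup>2 / app n M x k = (app n M g k)\<^sup>2 / D k"
        by (metis times_divide_eq_left mult.commute mult.right_neutral times_divide_eq_right)
      then show "x k * (app n M g k)\<^sup>2 / app n M x k = D k * (g k - y k) * (g k - y k)"
        using D[OF k] by (simp add: Mg[OF k] power2_eq_square)
    qed
    finally have "(\<Sum>k<n. D k * g k * (g k - y k)) \<le> (\<Sum>k<n. D k * (g k - y k) * (g k - y k))" .
    moreover have "(\<Sum>k<n. D k * (g k - y k) * (g k - y k)) - (\<Sum>k<n. D k * g k * (g k - y k))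
        = (\<Sum>k<n. D k * y k * y k) - (\<Sum>k<n. D k * g k * y k)"
      unfolding sum_subtractf[symmetric] by (intro sum.cong) (simp_all add: algebra_simps)
    ultimately have test: "(\<Sum>k<n. D k * g k * y k) \<le> (\<Sum>k<n. D k * y k * y k)"
      by linarith
    have yLg: "form n L y g = (\<Sum>k<n. D k * y k * y k)"
      unfolding dot_def by (simp add: Lg algebra_simps)
    have gLg: "form n L g g = (\<Sum>k<n. D k * g k * y k)"
      unfolding dot_def by (simp add: Lg algebra_simps)
    define N where "N = (\<Sum>k<n. D k * y k * y k)"
    have N: "0 \<le> N" unfolding N_def using D by (intro sum_nonneg) (auto simp: less_imp_le mult.assoc)
    \<comment> \<open>By \<open>L g = D y\<close>, both \<open>form n L y g\<close> and the bound on
      \<open>form n L g g\<close> equal \<open>N\<close>. Cancelling one \<open>N\<close> gives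
      \<open>N \<le> form n L y y\<close>, whose right side is
      \<open>N - form n M y y\<close>.\<close>
    have "N\<^sup>2 \<le> form n L y y * form n L g g"
      using form_Cauchy_Schwarz[where x=y and y=g, OF Lsym Lpsd] yLg by (simp add: N_def)
    also have "\<dots> \<le> form n L y y * N"
      using test gLg Lpsd by (intro mult_left_mono) (auto simp: N_def)
    finally have "N * N \<le> form n L y y * N" by (simp add: power2_eq_square)
    then have le: "N \<le> form n L y y"
      using N Lpsd[of y] by (cases "N = 0") auto
    then show ?thesis by (simp add: Lform N_def)
  qed
  \<comment> \<open>This \<open>s\<close> projects \<open>y\<close> along \<open>x\<close> onto the
    \<open>M\<close>-orthogonal complement of \<open>x\<close>.\<close>
  define s where "s = - form n M x y / form n M x x"
  define y' where "y' i = y i + s * x i" for i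
  have "dot n w y' = form n M x y + s * form n M x x"
    unfolding w_def y'_def dot_add_scale_right
    using form_commute[where x=x and y=y, OF sym] by (simp add: dot_commute)
  then have "dot n w y' = 0" using xMx by (simp add: s_def)
  then have "form n M y' y' \<le> 0" by (rule orth)
  then have "form n M y y + 2 * s * form n M x y + s\<^sup>2 * form n M x x \<le> 0"
    using form_add_scale[where x=y and y=x and s=s, OF sym] form_commute[where x=x and y=y, OF sym]
    by (simp add: y'_def[abs_def])
  then show ?thesis using xMx by (simp add: s_def field_simps power2_eq_square)
qed

section \<open>Volumes of cliques\<close>

text \<open>One vertex of the clique is mapped to \<open>k\<close>, and its edges to the remaining
  vertices are absorbed into their weights. Every later induction on the clique size follows this
  recursion.\<close>

fun clique_vol :: "nat \<Rightarrow> (nat \<Rightarrow> nat \<Rightarrow> real) \<Rightarrow> nat \<Rightarrow> (nat \<Rightarrow> real) \<Rightarrow> real" where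
  "clique_vol n g 0 x = 1"
| "clique_vol n g (Suc t) x = (\<Sum>k<n. x k * clique_vol n g t (\<lambda>i. g k i * x i))"

text \<open>The mixed volume of \<open>K\<^sub>t\<^sub>+\<^sub>1\<close> with one argument \<open>d\<close> and \<open>t\<close> arguments \<open>x\<close>.\<close>

definition polar_vol :: "nat \<Rightarrow> (nat \<Rightarrow> nat \<Rightarrow> real) \<Rightarrow> nat \<Rightarrow> (nat \<Rightarrow> real) \<Rightarrow> (nat \<Rightarrow> real) \<Rightarrow> real" where
  "polar_vol n g t x d = (\<Sum>k<n. d k * clique_vol n g t (\<lambda>i. g k i * x i))"

text \<open>The mixed volume of \<open>K\<^sub>m\<^sub>+\<^sub>2\<close> with \<open>m\<close> arguments equal to \<open>x\<close>, as a matrix in the two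
  remaining ones; it is the Hessian of the volume at \<open>x\<close> up to a factor.\<close>

definition hess :: "nat \<Rightarrow> (nat \<Rightarrow> nat \<Rightarrow> real) \<Rightarrow> nat \<Rightarrow> (nat \<Rightarrow> real) \<Rightarrow> nat \<Rightarrow> nat \<Rightarrow> real" where
  "hess n g m x k l = g k l * clique_vol n g m (\<lambda>i. g k i * (g l i * x i))"

lemma hess_0 [simp]: "hess n g 0 x = g"
  by (simp add: hess_def fun_eq_iff)

lemma clique_vol_pos:
  assumes "0 < n" "\<And>i j. i < n \<Longrightarrow> j < n \<Longrightarrow> 0 < g i j"
  shows "(\<And>i. i < n \<Longrightarrow> 0 < x i) \<Longrightarrow> 0 < clique_vol n g t x"
proof (induction t arbitrary: x)
  case (Suc t)
  show ?case using assms Suc by (auto intro!: sum_pos mult_pos_pos)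
qed simp

lemma clique_vol_Suc: "clique_vol n g (Suc t) x = polar_vol n g t x x"
  by (simp add: polar_vol_def)

lemma clique_vol_scale: "clique_vol n g t (\<lambda>i. c * x i) = c ^ t * clique_vol n g t x"
proof (induction t arbitrary: x)
  case (Suc t)
  have "(\<lambda>i. g k i * (c * x i)) = (\<lambda>i. c * (g k i * x i))" for k
    by (simp add: fun_eq_iff)
  then show ?case by (simp add: Suc sum_distrib_left mult_ac)
qed simp

lemma polar_vol_scale_left: "polar_vol n g t (\<lambda>i. c * x i) d = c ^ t * polar_vol n g t x d"
proof -
  have "(\<lambda>i. g k i * (c * x i)) = (\<lambda>i. c * (g k i * x i))" for k
    by (simp add: fun_eq_iff)
  then show ?thesis by (simp add: polar_vol_def clique_vol_scale sum_distrib_left mult_ac)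
qed

lemma polar_vol_scale_right: "polar_vol n g t x (\<lambda>i. c * d i) = c * polar_vol n g t x d"
  by (simp add: polar_vol_def sum_distrib_left mult_ac)

section \<open>Mixed volumes, Hessians and directional derivatives\<close>

context
  fixes n :: nat and g :: "nat \<Rightarrow> nat \<Rightarrow> real"
  assumes sym: "\<And>i j. g i j = g j i"
begin

lemma hess_sym: "hess n g m x k l = hess n g m x l k"
  using sym[of k l] by (simp add: hess_def mult.left_commute)

lemma form_hess: "form n (hess n g m x) d e = (\<Sum>k<n. d k * polar_vol n g m (\<lambda>i. g k i * x i) (\<lambda>i. g k i * e i))"
  unfolding dot_def app_def polar_vol_def hess_def
  by (simp add: mult_ac)

text \<open>Mixed volumes do not depend on the order in which vertices are mapped: on the left a
  vertex with argument \<open>x\<close> goes first, on the right the one with \<open>d\<close>.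
  Interchanging the sums identifies them.\<close>

lemma polar_vol_Suc:
  "(\<Sum>k<n. x k * polar_vol n g t (\<lambda>i. g k i * x i) (\<lambda>i. g k i * d i)) = polar_vol n g (Suc t) x d"
proof -
  have "(\<Sum>k<n. x k * polar_vol n g t (\<lambda>i. g k i * x i) (\<lambda>i. g k i * d i)) =
      (\<Sum>k<n. \<Sum>l<n. x k * (g k l * d l * clique_vol n g t (\<lambda>i. g l i * (g k i * x i))))"
    by (simp add: polar_vol_def sum_distrib_left)
  also have "\<dots> = (\<Sum>l<n. \<Sum>k<n. x k * (g k l * d l * clique_vol n g t (\<lambda>i. g l i * (g k i * x i))))"
    by (rule sum.swap)
  also have "\<dots> = polar_vol n g (Suc t) x d"
    unfolding polar_vol_def clique_vol.simps sum_distrib_left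
    by (intro sum.cong refl) (auto simp: mult_ac sym)
  finally show ?thesis .
qed

text \<open>Euler's relation for a homogeneous polynomial: the Hessian applied to the base point
  returns the gradient, up to factors.\<close>

lemma form_hess_self: "form n (hess n g m x) x e = polar_vol n g (Suc m) x e"
  by (simp add: form_hess polar_vol_Suc)

text \<open>Fixing the image \<open>j\<close> of one of the vertices with argument \<open>x\<close>
  leaves a Hessian form of a smaller clique; this drives the induction for the Alexandrov-Fenchel
  inequality.\<close>

lemma form_hess_Suc:
  "form n (hess n g (Suc m) x) d e =
    (\<Sum>j<n. x j * form n (hess n g m (\<lambda>i. g j i * x i)) (\<lambda>i. g j i * d i) (\<lambda>i. g j i * e i))"
proof -
  have "form n (hess n g (Suc m) x) d e = (\<Sum>k<n. \<Sum>l<n. \<Sum>j<n. x j * (g j k * d k * (g k l *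
      clique_vol n g m (\<lambda>i. g k i * (g l i * (g j i * x i))) * (g j l * e l))))"
    unfolding dot_def app_def hess_def clique_vol.simps sum_distrib_left sum_distrib_right
    by (intro sum.cong refl) (auto simp: mult_ac sym)
  also have "\<dots> = (\<Sum>k<n. \<Sum>j<n. \<Sum>l<n. x j * (g j k * d k * (g k l *
      clique_vol n g m (\<lambda>i. g k i * (g l i * (g j i * x i))) * (g j l * e l))))"
    by (intro sum.cong refl sum.swap)
  also have "\<dots> = (\<Sum>j<n. \<Sum>k<n. \<Sum>l<n. x j * (g j k * d k * (g k l *
      clique_vol n g m (\<lambda>i. g k i * (g l i * (g j i * x i))) * (g j l * e l))))"
    by (rule sum.swap)
  finally show ?thesis
    by (simp add: dot_def app_def hess_def sum_distrib_left)
qed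

text \<open>Here the vertex mapped to \<open>k\<close> is one of the two free ones. The terms of the
  Bochner condition thereby become Hessian forms of a smaller clique.\<close>

lemma app_hess_Suc:
  "app n (hess n g (Suc m) x) e k = form n (hess n g m (\<lambda>i. g k i * x i)) (\<lambda>i. g k i * x i) (\<lambda>i. g k i * e i)"
proof -
  have "app n (hess n g (Suc m) x) e k = (\<Sum>l<n. \<Sum>j<n. g k j * x j * (g j l *
      clique_vol n g m (\<lambda>i. g j i * (g l i * (g k i * x i))) * (g k l * e l)))"
    unfolding app_def hess_def clique_vol.simps sum_distrib_left sum_distrib_right
    by (intro sum.cong refl) (auto simp: mult_ac sym)
  also have "\<dots> = (\<Sum>j<n. \<Sum>l<n. g k j * x j * (g j l *
      clique_vol n g m (\<lambda>i. g j i * (g l i * (g k i * x i))) * (g k l * e l)))"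
    by (rule sum.swap)
  finally show ?thesis
    by (simp add: dot_def app_def hess_def sum_distrib_left)
qed

text \<open>The product rule gives one mixed volume from the vertex mapped first and, by induction,
  further terms that \<open>polar_vol_Suc\<close> turns into copies of the same mixed
  volume.\<close>

lemma clique_vol_has_derivative:
  "((\<lambda>s. clique_vol n g (Suc t) (\<lambda>i. x i + s * d i)) has_real_derivative
    real (Suc t) * polar_vol n g t (\<lambda>i. x i + s * d i) d) (at s)"
proof (induction t arbitrary: x d)
  case 0
  show ?case by (auto simp: polar_vol_def intro!: derivative_eq_intros)
next
  case (Suc t)
  have eq: "(\<lambda>i. g k i * (x i + s * d i)) = (\<lambda>i. g k i * x i + s * (g k i * d i))" for k s
    by (simp add: fun_eq_iff algebra_simps)
  let ?x = "\<lambda>i. x i + s * d i"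
  have "((\<lambda>s. \<Sum>k<n. (x k + s * d k) * clique_vol n g (Suc t) (\<lambda>i. g k i * (x i + s * d i)))
    has_real_derivative (\<Sum>k<n. (0 + 1 * d k) * clique_vol n g (Suc t) (\<lambda>i. g k i * ?x i)
      + real (Suc t) * polar_vol n g t (\<lambda>i. g k i * ?x i) (\<lambda>i. g k i * d i) * ?x k)) (at s)"
    unfolding eq
    by (intro DERIV_sum DERIV_mult DERIV_add DERIV_const DERIV_cmult_right DERIV_ident Suc)
  moreover have "(\<Sum>k<n. (0 + 1 * d k) * clique_vol n g (Suc t) (\<lambda>i. g k i * ?x i)
      + real (Suc t) * polar_vol n g t (\<lambda>i. g k i * ?x i) (\<lambda>i. g k i * d i) * ?x k)
    = polar_vol n g (Suc t) ?x d
      + real (Suc t) * (\<Sum>k<n. ?x k * polar_vol n g t (\<lambda>i. g k i * ?x i) (\<lambda>i. g k i * d i))"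
    by (simp add: polar_vol_def[of n g "Suc t"] sum.distrib sum_distrib_left mult_ac del: clique_vol.simps)
  ultimately show ?case
    unfolding polar_vol_Suc clique_vol.simps(2)[of n g "Suc t"] by (simp add: algebra_simps del: clique_vol.simps)
qed

lemma polar_vol_has_derivative:
  "((\<lambda>s. polar_vol n g (Suc m) (\<lambda>i. x i + s * d i) d) has_real_derivative
    real (Suc m) * form n (hess n g m (\<lambda>i. x i + s * d i)) d d) (at s)"
proof -
  have eq: "(\<lambda>i. g k i * (x i + s * d i)) = (\<lambda>i. g k i * x i + s * (g k i * d i))" for k s
    by (simp add: fun_eq_iff algebra_simps)
  have "((\<lambda>s. polar_vol n g (Suc m) (\<lambda>i. x i + s * d i) d) has_real_derivative
     (\<Sum>k<n. d k * (real (Suc m) * polar_vol n g m (\<lambda>i. g k i * (x i + s * d i)) (\<lambda>i. g k i * d i)))) (at s)"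
    unfolding polar_vol_def[of n g "Suc m"] eq
    by (intro DERIV_sum DERIV_cmult clique_vol_has_derivative)
  then show ?thesis by (simp add: form_hess sum_distrib_left mult_ac)
qed

end

section \<open>The Alexandrov-Fenchel inequality for cliques\<close>

text \<open>The bound by a squared linear functional encodes at most one positive eigenvalue:
  \<open>M\<close> is nonpositive on the kernel of \<open>r\<close>, and the line through
  \<open>y\<close> in direction \<open>x\<close> meets that kernel.\<close>

lemma form_reverse_Cauchy_Schwarz:
  assumes sym: "\<And>i j. i < n \<Longrightarrow> j < n \<Longrightarrow> M i j = M j i"
    and lor: "\<And>y. form n M y y \<le> (dot n r y)\<^sup>2" and x: "0 < form n M x x"
  shows "form n M y y * form n M x x \<le> (form n M x y)\<^sup>2"
proof -
  have "0 < (dot n r x)\<^sup>2" using lor[of x] x by linarith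
  then have rx: "dot n r x \<noteq> 0" by auto
  define s where "s = - dot n r y / dot n r x"
  have "dot n r (\<lambda>i. y i + s * x i) = 0"
    unfolding dot_add_scale_right s_def using rx by simp
  then have "form n M (\<lambda>i. y i + s * x i) (\<lambda>i. y i + s * x i) \<le> 0"
    using lor[of "\<lambda>i. y i + s * x i"] by simp
  then have le: "form n M y y + 2 * s * form n M x y + s\<^sup>2 * form n M x x \<le> 0"
    using form_add_scale[where x=y and y=x and s=s, OF sym] form_commute[where x=x and y=y, OF sym]
    by simp
  \<comment> \<open>Completing the square in \<open>s\<close> leaves the difference of the two sides
    of the claim plus the square below.\<close>
  have "form n M x x * (form n M y y + 2 * s * form n M x y + s\<^sup>2 * form n M x x) \<le> 0"
    using le x by (simp add: mult_nonneg_nonpos)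
  moreover have "0 \<le> (s * form n M x x + form n M x y)\<^sup>2" by simp
  ultimately show ?thesis by (simp add: power2_eq_square algebra_simps)
qed

text \<open>For \<open>m = 0\<close> the Hessian is \<open>g\<close>. In the step,
  \<open>form_hess_Suc\<close> splits the form by the image \<open>k\<close> of a vertex, the
  induction hypothesis with weights \<open>g k i * x i\<close> bounds each piece, and by
  \<open>app_hess_Suc\<close> the sum of these bounds is exactly the Bochner condition.\<close>

lemma hess_reverse_Cauchy_Schwarz:
  assumes n: "0 < n" and sym: "\<And>i j. g i j = g j i"
    and pos: "\<And>i j. i < n \<Longrightarrow> j < n \<Longrightarrow> 0 < g i j"
    and lor: "\<And>y. form n g y y \<le> (dot n r y)\<^sup>2"
  shows "(\<And>i. i < n \<Longrightarrow> 0 < x i) \<Longrightarrow>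
    form n (hess n g m x) y y * form n (hess n g m x) x x \<le> (form n (hess n g m x) x y)\<^sup>2"
proof (induction m arbitrary: x y)
  case 0
  have "0 < form n g x x"
    using n unfolding dot_def app_def by (auto intro!: sum_pos mult_pos_pos pos 0)
  then show ?case using form_reverse_Cauchy_Schwarz[of n g r x y] sym lor by simp
next
  case (Suc m)
  have hess_pos: "0 < hess n g m x i j" if "i < n" "j < n" "\<And>i. i < n \<Longrightarrow> 0 < x i" for m x i j
    unfolding hess_def using that n by (auto intro!: mult_pos_pos pos clique_vol_pos)
  show ?case
  proof (rule Bochner_reverse_Cauchy_Schwarz)
    fix z
    have "form n (hess n g (Suc m) x) z z \<le> (\<Sum>k<n. x k *
       ((form n (hess n g m (\<lambda>i. g k i * x i)) (\<lambda>i. g k i * x i) (\<lambda>i. g k i * z i))\<^sup>2 /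
       form n (hess n g m (\<lambda>i. g k i * x i)) (\<lambda>i. g k i * x i) (\<lambda>i. g k i * x i)))"
      unfolding form_hess_Suc[OF sym]
    proof (intro sum_mono mult_left_mono)
      fix k assume "k \<in> {..<n}"
      then have k: "k < n" by simp
      then show "0 \<le> x k" using Suc.prems less_imp_le by blast
      have gx: "\<And>i. i < n \<Longrightarrow> 0 < g k i * x i" using pos Suc.prems k by auto
      have "0 < form n (hess n g m (\<lambda>i. g k i * x i)) (\<lambda>i. g k i * x i) (\<lambda>i. g k i * x i)"
        using n unfolding dot_def app_def by (auto intro!: sum_pos mult_pos_pos[OF gx] mult_pos_pos hess_pos gx)
      with Suc.IH[OF gx, where y = "\<lambda>i. g k i * z i"]
      show "form n (hess n g m (\<lambda>i. g k i * x i)) (\<lambda>i. g k i * z i) (\<lambda>i. g k i * z i) \<le>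
        (form n (hess n g m (\<lambda>i. g k i * x i)) (\<lambda>i. g k i * x i) (\<lambda>i. g k i * z i))\<^sup>2 /
        form n (hess n g m (\<lambda>i. g k i * x i)) (\<lambda>i. g k i * x i) (\<lambda>i. g k i * x i)"
        by (simp add: pos_le_divide_eq)
    qed
    then show "form n (hess n g (Suc m) x) z z \<le>
        (\<Sum>k<n. x k * (app n (hess n g (Suc m) x) z k)\<^sup>2 / app n (hess n g (Suc m) x) x k)"
      by (simp add: app_hess_Suc[OF sym])
  qed (use hess_sym[OF sym] hess_pos Suc.prems in auto)
qed

section \<open>Log-concavity and the exchange of one argument\<close>

text \<open>Along the segment from \<open>a\<close> to \<open>b\<close> the logarithm of the volume
  is concave, so equal end values force a nonnegative slope at \<open>a\<close>. That slope is a
  positive multiple of the difference of the two sides.\<close>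

lemma clique_vol_eq_le_polar_vol:
  assumes n: "0 < n" and sym: "\<And>i j. g i j = g j i"
    and pos: "\<And>i j. i < n \<Longrightarrow> j < n \<Longrightarrow> 0 < g i j"
    and lor: "\<And>y. form n g y y \<le> (dot n r y)\<^sup>2"
    and a: "\<And>i. i < n \<Longrightarrow> 0 < a i" and b: "\<And>i. i < n \<Longrightarrow> 0 < b i"
    and eq: "clique_vol n g (Suc t) a = clique_vol n g (Suc t) b"
  shows "clique_vol n g (Suc t) a \<le> polar_vol n g t a b"
proof (cases t)
  case 0
  then show ?thesis using eq by (simp add: polar_vol_def)
next
  case (Suc m)
  define d where "d i = b i - a i" for i
  define X where "X s = (\<lambda>i. a i + s * d i)" for s
  define P where "P s = clique_vol n g (Suc (Suc m)) (X s)" for s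
  define F where "F s = polar_vol n g (Suc m) (X s) d" for s
  define E where "E s = form n (hess n g m (X s)) d d" for s
  have Xpos: "0 < X s i" if "0 \<le> s" "s \<le> 1" "i < n" for s i
  proof -
    have "X s i = (1 - s) * a i + s * b i" by (simp add: X_def d_def algebra_simps)
    moreover have "0 < (1 - s) * a i + s * b i"
    proof (cases "s = 0")
      case False
      then have "0 < s * b i" using that b by simp
      moreover have "0 \<le> (1 - s) * a i" using that a[OF \<open>i < n\<close>] by simp
      ultimately show ?thesis by linarith
    qed (simp add: a that)
    ultimately show ?thesis by simp
  qed
  have Ppos: "0 < P s" if "0 \<le> s" "s \<le> 1" for s
    unfolding P_def using n pos Xpos[OF that] by (rule clique_vol_pos)
  have P': "(P has_real_derivative real (Suc (Suc m)) * F s) (at s)" for s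
    unfolding P_def F_def X_def by (rule clique_vol_has_derivative[OF sym])
  have F': "(F has_real_derivative real (Suc m) * E s) (at s)" for s
    unfolding F_def E_def X_def by (rule polar_vol_has_derivative[OF sym])
  have AF: "E s * P s \<le> (F s)\<^sup>2" if "0 \<le> s" "s \<le> 1" for s
    using hess_reverse_Cauchy_Schwarz[where m = m and y = d, OF n sym pos lor Xpos[OF that]]
    unfolding form_hess_self[OF sym] E_def P_def F_def clique_vol_Suc .
  \<comment> \<open>\<open>F / P\<close> is nonincreasing, being the logarithmic derivative of \<open>P\<close> up to a factor, whereas \<open>P 0 = P 1\<close>.\<close>
  have "0 \<le> F 0"
  proof (rule ccontr)
    assume "\<not> 0 \<le> F 0"
    then have F0: "F 0 < 0" by simp
    have Fneg: "F s < 0" if s: "0 \<le> s" "s \<le> 1" for s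
    proof -
      have "F s / P s \<le> F 0 / P 0"
      proof (rule DERIV_nonpos_imp_nonincreasing[OF s(1)])
        fix u assume "0 \<le> u" "u \<le> s"
        then have u: "0 \<le> u" "u \<le> 1" using s by auto
        have "((\<lambda>s. F s / P s) has_real_derivative
            (real (Suc m) * E u * P u - F u * (real (Suc (Suc m)) * F u)) / (P u * P u)) (at u)"
          using Ppos[OF u] by (intro DERIV_divide F' P') auto
        moreover have "real (Suc m) * E u * P u - F u * (real (Suc (Suc m)) * F u) \<le> 0"
        proof -
          have "real (Suc m) * (E u * P u) \<le> real (Suc m) * (F u)\<^sup>2"
            using AF[OF u] by (intro mult_left_mono) auto
          also have "\<dots> \<le> real (Suc (Suc m)) * (F u)\<^sup>2"
            by (intro mult_right_mono) auto
          finally show ?thesis by (simp add: power2_eq_square algebra_simps)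
        qed
        ultimately show "\<exists>y. ((\<lambda>s. F s / P s) has_real_derivative y) (at u) \<and> y \<le> 0"
          by (meson divide_nonpos_nonneg zero_le_square)
      qed
      also have "\<dots> < 0" using F0 Ppos[of 0] by (simp add: divide_neg_pos)
      finally show ?thesis using Ppos[OF s] by (simp add: divide_less_0_iff)
    qed
    have "P 1 < P 0"
      using P' Fneg by (intro DERIV_neg_imp_decreasing[of 0 1]) (auto intro!: exI mult_pos_neg)
    moreover have "P 0 = P 1" using eq by (simp add: P_def X_def d_def Suc del: clique_vol.simps)
    ultimately show False by simp
  qed
  also have "F 0 = polar_vol n g t a b - clique_vol n g (Suc t) a"
    by (simp add: F_def X_def d_def Suc polar_vol_def algebra_simps sum_subtractf del: clique_vol.simps(2))
       (simp add: algebra_simps)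
  finally show ?thesis by simp
qed

text \<open>Rescaling \<open>b\<close> by \<open>c\<close> makes both volumes equal. The two
  resulting inequalities carry the factors \<open>c\<close> and \<open>c ^ t\<close>, whose product
  \<open>A / B\<close> undoes the rescaling.\<close>

lemma clique_vol_mult_le_polar_vol_pos:
  assumes n: "0 < n" and sym: "\<And>i j. g i j = g j i"
    and pos: "\<And>i j. i < n \<Longrightarrow> j < n \<Longrightarrow> 0 < g i j"
    and lor: "\<And>y. form n g y y \<le> (dot n r y)\<^sup>2"
    and a: "\<And>i. i < n \<Longrightarrow> 0 < a i" and b: "\<And>i. i < n \<Longrightarrow> 0 < b i"
  shows "clique_vol n g (Suc t) a * clique_vol n g (Suc t) b \<le> polar_vol n g t a b * polar_vol n g t b a"
proof -
  define A where "A = clique_vol n g (Suc t) a"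
  define B where "B = clique_vol n g (Suc t) b"
  have A: "0 < A" and B: "0 < B"
    unfolding A_def B_def by (intro clique_vol_pos n pos a b; assumption)+
  define c where "c = root (Suc t) (A / B)"
  have c: "0 < c" "c ^ Suc t = A / B"
    using A B by (auto simp: c_def real_root_gt_zero real_root_pow_pos simp del: power_Suc)
  define b' where "b' i = c * b i" for i
  have b': "0 < b' i" if "i < n" for i using b[OF that] c by (simp add: b'_def)
  have "clique_vol n g (Suc t) b' = A / B * B"
    unfolding c(2)[symmetric] unfolding b'_def B_def by (rule clique_vol_scale)
  then have Vb': "clique_vol n g (Suc t) b' = A" using B by (simp del: clique_vol.simps)
  have "A \<le> polar_vol n g t a b'"
    unfolding A_def by (rule clique_vol_eq_le_polar_vol[OF n sym pos lor a b']) (simp_all only: Vb' A_def)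
  then have 1: "A \<le> c * polar_vol n g t a b" by (simp add: b'_def[abs_def] polar_vol_scale_right)
  have "clique_vol n g (Suc t) b' \<le> polar_vol n g t b' a"
    by (rule clique_vol_eq_le_polar_vol[OF n sym pos lor b' a]) (simp_all only: Vb' A_def)
  then have 2: "A \<le> c ^ t * polar_vol n g t b a" unfolding Vb' by (simp add: b'_def[abs_def] polar_vol_scale_left)
  have "A * A \<le> (c * polar_vol n g t a b) * (c ^ t * polar_vol n g t b a)"
    using 1 2 A by (intro mult_mono) auto
  also have "\<dots> = c ^ Suc t * (polar_vol n g t a b * polar_vol n g t b a)" by simp
  also have "\<dots> = A / B * (polar_vol n g t a b * polar_vol n g t b a)" by (simp only: c(2))
  finally have "A * (A * B) \<le> A * (polar_vol n g t a b * polar_vol n g t b a)"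
    using B by (simp add: field_simps)
  then show ?thesis using A by (simp add: A_def B_def del: clique_vol.simps)
qed

section \<open>Passage to nonnegative weights by perturbation\<close>

lemma tendsto_clique_vol:
  assumes "\<And>k i. ((\<lambda>e. g e k i) \<longlongrightarrow> g0 k i) F"
  shows "(\<And>i. ((\<lambda>e. x e i) \<longlongrightarrow> x0 i) F) \<Longrightarrow>
    ((\<lambda>e. clique_vol n (g e) t (x e)) \<longlongrightarrow> clique_vol n g0 t x0) F"
proof (induction t arbitrary: x x0)
  case (Suc t)
  show ?case unfolding clique_vol.simps
    by (intro tendsto_sum tendsto_mult Suc.IH Suc.prems assms)
qed simp

lemma tendsto_polar_vol:
  assumes "\<And>k i. ((\<lambda>e. g e k i) \<longlongrightarrow> g0 k i) F" "\<And>i. ((\<lambda>e. x e i) \<longlongrightarrow> x0 i) F"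
    "\<And>i. ((\<lambda>e. d e i) \<longlongrightarrow> d0 i) F"
  shows "((\<lambda>e. polar_vol n (g e) t (x e) (d e)) \<longlongrightarrow> polar_vol n g0 t x0 d0) F"
  unfolding polar_vol_def by (intro tendsto_sum tendsto_mult tendsto_clique_vol assms)

text \<open>Adding \<open>e * r i + e * r j + e\<^sup>2\<close> to the weights replaces \<open>r\<close> by \<open>r + e\<close> in the bound on the quadratic
  form, so it gives strictly positive weights that still have at most one positive eigenvalue.\<close>

lemma clique_vol_mult_le_polar_vol:
  assumes sym: "\<And>i j. g i j = g j i"
    and nonneg: "\<And>i j. i < n \<Longrightarrow> j < n \<Longrightarrow> 0 \<le> g i j"
    and r: "\<And>i. i < n \<Longrightarrow> 0 \<le> r i"
    and lor: "\<And>y. form n g y y \<le> (dot n r y)\<^sup>2"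
    and a: "\<And>i. i < n \<Longrightarrow> 0 \<le> a i" and b: "\<And>i. i < n \<Longrightarrow> 0 \<le> b i"
  shows "clique_vol n g (Suc t) a * clique_vol n g (Suc t) b \<le> polar_vol n g t a b * polar_vol n g t b a"
proof (cases "n = 0")
  case True
  then show ?thesis by (simp add: polar_vol_def)
next
  case False
  define h where "h e i j = g i j + (e * r i + e * r j + e * e)" for e i j
  define a' where "a' e i = a i + e" for e i
  define b' where "b' e i = b i + e" for e i
  have h: "((\<lambda>e. h e i j) \<longlongrightarrow> g i j) (at_right 0)" for i j
    unfolding h_def by (auto intro!: tendsto_eq_intros)
  have a': "((\<lambda>e. a' e i) \<longlongrightarrow> a i) (at_right 0)" for i
    unfolding a'_def by (auto intro!: tendsto_eq_intros)
  have b': "((\<lambda>e. b' e i) \<longlongrightarrow> b i) (at_right 0)" for i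
    unfolding b'_def by (auto intro!: tendsto_eq_intros)
  have le: "clique_vol n (h e) (Suc t) (a' e) * clique_vol n (h e) (Suc t) (b' e) \<le>
    polar_vol n (h e) t (a' e) (b' e) * polar_vol n (h e) t (b' e) (a' e)" if e: "0 < e" for e
  proof (rule clique_vol_mult_le_polar_vol_pos[where r = "\<lambda>i. r i + e * 1"])
    show "h e i j = h e j i" for i j using sym[of i j] by (simp add: h_def)
    show "0 < h e i j" if "i < n" "j < n" for i j
      unfolding h_def using nonneg[OF that] r[OF that(1)] r[OF that(2)] e
      by (intro add_nonneg_pos) auto
    show "form n (h e) y y \<le> (dot n (\<lambda>i. r i + e * 1) y)\<^sup>2" for y
    proof -
      \<comment> \<open>With these abbreviations the perturbation adds
        \<open>T\<^sup>2 - (dot n r y)\<^sup>2\<close> to the form, and \<open>T\<close> is the new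
        linear functional at \<open>y\<close>.\<close>
      define S where "S = dot n (\<lambda>_. 1) y"
      define T where "T = dot n r y + e * S"
      have app: "app n (h e) y = (\<lambda>i. app n g y i + (e * S) * r i + (e * T) * 1)"
        by (simp add: fun_eq_iff app_def h_def dot_def S_def T_def algebra_simps sum.distrib sum_distrib_left)
      have "form n (h e) y y = form n g y y + (e * S) * dot n r y + (e * T) * S"
        unfolding app dot_add_scale_right S_def by (simp only: dot_commute[of n y])
      then show ?thesis using lor[of y]
        unfolding dot_add_scale_left by (simp add: T_def S_def power2_eq_square algebra_simps)
    qed
  qed (use False a b e in \<open>auto simp: a'_def b'_def add_nonneg_pos\<close>)
  show ?thesis
  proof (rule tendsto_le[OF trivial_limit_at_right_real])
    show "((\<lambda>e. polar_vol n (h e) t (a' e) (b' e) * polar_vol n (h e) t (b' e) (a' e)) \<longlongrightarrow>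
      polar_vol n g t a b * polar_vol n g t b a) (at_right 0)"
      by (intro tendsto_mult tendsto_polar_vol h a' b')
    show "((\<lambda>e. clique_vol n (h e) (Suc t) (a' e) * clique_vol n (h e) (Suc t) (b' e)) \<longlongrightarrow>
      clique_vol n g (Suc t) a * clique_vol n g (Suc t) b) (at_right 0)"
      by (intro tendsto_mult tendsto_clique_vol h a' b')
    show "\<forall>\<^sub>F e in at_right 0. clique_vol n (h e) (Suc t) (a' e) * clique_vol n (h e) (Suc t) (b' e) \<le>
      polar_vol n (h e) t (a' e) (b' e) * polar_vol n (h e) t (b' e) (a' e)"
      using eventually_at_right_less[of "0::real"] by eventually_elim (rule le)
  qed
qed

text \<open>The recursion removes the pair of vertices \<open>(t, 1)\<close>, \<open>(t, 2)\<close> of \<open>K\<^sub>t\<^sub>+\<^sub>1 \<times> K\<^sub>2\<close>, mapped to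
  \<open>k\<close> and \<open>l\<close>.\<close>

fun double_vol :: "nat \<Rightarrow> (nat \<Rightarrow> nat \<Rightarrow> real) \<Rightarrow> nat \<Rightarrow> (nat \<Rightarrow> real) \<Rightarrow> (nat \<Rightarrow> real) \<Rightarrow> real" where
  "double_vol n g 0 a b = 1"
| "double_vol n g (Suc t) a b =
    (\<Sum>k<n. \<Sum>l<n. a k * b l * double_vol n g t (\<lambda>i. g l i * a i) (\<lambda>i. g k i * b i))"

text \<open>After one exchange of arguments, expanding the product of mixed volumes over the images
  of the exchanged vertices leaves products of two smaller clique volumes, to which the induction
  hypothesis applies.\<close>

lemma clique_vol_mult_le_double_vol:
  assumes sym: "\<And>i j. g i j = g j i"
    and nonneg: "\<And>i j. i < n \<Longrightarrow> j < n \<Longrightarrow> 0 \<le> g i j"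
    and r: "\<And>i. i < n \<Longrightarrow> 0 \<le> r i"
    and lor: "\<And>y. form n g y y \<le> (dot n r y)\<^sup>2"
  shows "(\<And>i. i < n \<Longrightarrow> 0 \<le> a i) \<Longrightarrow> (\<And>i. i < n \<Longrightarrow> 0 \<le> b i) \<Longrightarrow>
    clique_vol n g t a * clique_vol n g t b \<le> double_vol n g t a b"
proof (induction t arbitrary: a b)
  case (Suc t)
  have "clique_vol n g (Suc t) a * clique_vol n g (Suc t) b \<le> polar_vol n g t a b * polar_vol n g t b a"
    by (rule clique_vol_mult_le_polar_vol[OF sym nonneg r lor Suc.prems])
  \<comment> \<open>The factors are commuted so that \<open>k\<close> is the image carrying
    \<open>a\<close> and \<open>l\<close> the one carrying \<open>b\<close>, as in
    \<open>double_vol\<close>.\<close>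
  also have "\<dots> = polar_vol n g t b a * polar_vol n g t a b" by simp
  also have "\<dots> = (\<Sum>k<n. \<Sum>l<n. a k * b l * (clique_vol n g t (\<lambda>i. g l i * a i) * clique_vol n g t (\<lambda>i. g k i * b i)))"
    unfolding polar_vol_def sum_product by (simp add: mult_ac)
  also have "\<dots> \<le> double_vol n g (Suc t) a b"
    unfolding double_vol.simps
    using Suc.prems nonneg by (intro sum_mono mult_left_mono Suc.IH) auto
  finally show ?case .
qed simp

section \<open>Antiferromagnetic matrices\<close>

text \<open>In the space of all functions the sphere is not compact, since coordinates from
  \<open>n\<close> on are free. Setting them to 0 places it in a product of compact sets, and
  \<open>Q_cong\<close> shows that this loses nothing. Taking \<open>c = 0\<close> gives the whole
  sphere.\<close>

lemma exists_max_on_sphere: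
  fixes Q :: "(nat \<Rightarrow> real) \<Rightarrow> real"
  assumes Q: "continuous_on UNIV Q"
    and v: "dot n v v = 1" "dot n c v = 0"
    and Q_cong: "\<And>x y. (\<And>i. i < n \<Longrightarrow> x i = y i) \<Longrightarrow> Q x = Q y"
  shows "\<exists>x. dot n x x = 1 \<and> dot n c x = 0 \<and> (\<forall>y. dot n y y = 1 \<longrightarrow> dot n c y = 0 \<longrightarrow> Q y \<le> Q x)"
proof -
  have cont: "continuous_on UNIV (\<lambda>x::nat \<Rightarrow> real. x i)" for i
    by (rule continuous_on_product_coordinates)
  define K where "K = PiE UNIV (\<lambda>i. if i < n then {-1..1::real} else {0})"
  have "compactin (product_topology (\<lambda>i. euclidean) UNIV) K"
    unfolding K_def compactin_PiE by auto
  then have K: "compact K" by (simp add: euclidean_product_topology)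
  define S where "S = {x. dot n x x = 1} \<inter> {x. dot n c x = 0}"
  have "closed S" unfolding S_def dot_def
    by (intro closed_Int closed_Collect_eq continuous_intros cont)
  then have cpt: "compact (K \<inter> S)" using K by (simp add: compact_Int_closed)
  define res where "res y = (\<lambda>i. if i < n then y i else 0)" for y :: "nat \<Rightarrow> real"
  have res_dot: "dot n (res y) (res y) = dot n y y" "dot n c (res y) = dot n c y" for y
    by (auto simp: dot_def res_def)
  have res: "res y \<in> K \<inter> S" if "dot n y y = 1" "dot n c y = 0" for y
  proof -
    have "\<bar>y i\<bar> \<le> 1" if "i < n" for i
    proof -
      have "(y i)\<^sup>2 \<le> dot n y y"
        unfolding dot_def power2_eq_square using that by (intro member_le_sum) auto
      then show ?thesis using \<open>dot n y y = 1\<close> abs_square_le_1 by fastforce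
    qed
    then have "res y \<in> K" by (auto simp: K_def res_def abs_le_iff)
    then show ?thesis using that res_dot by (auto simp: S_def)
  qed
  have "K \<inter> S \<noteq> {}" using res[OF v] by blast
  from continuous_attains_sup[OF cpt this continuous_on_subset[OF Q]]
  obtain x where x: "x \<in> K \<inter> S" "\<And>y. y \<in> K \<inter> S \<Longrightarrow> Q y \<le> Q x" by auto
  have "Q y \<le> Q x" if "dot n y y = 1" "dot n c y = 0" for y
    using x(2)[OF res[OF that]] Q_cong[of "res y" y] by (simp add: res_def)
  then show ?thesis using x(1) by (auto simp: S_def)
qed

text \<open>Rayleigh's principle: the form attains its maximum on the unit sphere of the invariant
  hyperplane at an eigenvector, with the maximum as eigenvalue.\<close>

lemma positive_eigenvector_in_hyperplane:
  assumes sym: "\<And>i j. i < n \<Longrightarrow> j < n \<Longrightarrow> M i j = M j i"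
    and inv: "\<And>y. dot n c y = 0 \<Longrightarrow> dot n c (app n M y) = 0"
    and z: "dot n c z = 0" "0 < form n M z z"
  shows "\<exists>x e. 0 < e \<and> dot n x x = 1 \<and> dot n c x = 0 \<and> (\<forall>i<n. app n M x i = e * x i) \<and>
    (\<forall>y. dot n c y = 0 \<longrightarrow> form n M y y \<le> e * dot n y y)"
proof -
  have dot_nonneg: "0 \<le> dot n y y" for y by (auto simp: dot_def intro!: sum_nonneg)
  have dot_0: "y i = 0" if "dot n y y = 0" "i < n" for y i
    using that unfolding dot_def by (subst (asm) sum_nonneg_eq_0_iff) auto
  \<comment> \<open>The summand 0 brings the scaling into the shape of the \<open>add_scale\<close>
    lemmas.\<close>
  define nrm where "nrm y = (\<lambda>i. 0 + (1 / sqrt (dot n y y)) * y i)" for y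
  have nrm: "dot n (nrm y) (nrm y) = 1" "dot n c (nrm y) = dot n c y / sqrt (dot n y y)"
    "form n M (nrm y) (nrm y) = form n M y y / dot n y y" if "dot n y y \<noteq> 0" for y
  proof -
    have 0: "dot n (\<lambda>i. 0) u = 0" "dot n u (\<lambda>i. 0) = 0" "app n M (\<lambda>i. 0) = (\<lambda>i. 0)" for u
      by (simp_all add: dot_def app_def fun_eq_iff)
    have s: "sqrt (dot n y y) * sqrt (dot n y y) = dot n y y" "0 < dot n y y"
      using that dot_nonneg[of y] by auto
    show "dot n (nrm y) (nrm y) = 1" "dot n c (nrm y) = dot n c y / sqrt (dot n y y)"
      "form n M (nrm y) (nrm y) = form n M y y / dot n y y"
      unfolding nrm_def app_add_scale dot_add_scale_right dot_add_scale_left 0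
      using that s by (simp_all add: 0 field_simps)
  qed
  have pos: "dot n y y \<noteq> 0" if "form n M y y \<noteq> 0" for y
    using that dot_0[of y] by (auto simp: dot_def)
  have cont: "continuous_on UNIV (\<lambda>x. form n M x x)"
    unfolding dot_def app_def by (intro continuous_intros continuous_on_product_coordinates)
  have zn: "dot n z z \<noteq> 0" using z pos by simp
  have "\<exists>x. dot n x x = 1 \<and> dot n c x = 0 \<and>
      (\<forall>y. dot n y y = 1 \<longrightarrow> dot n c y = 0 \<longrightarrow> form n M y y \<le> form n M x x)"
  proof (rule exists_max_on_sphere[OF cont])
    show "dot n (nrm z) (nrm z) = 1" "dot n c (nrm z) = 0" using nrm[OF zn] z by auto
    show "\<And>x y. (\<And>i. i < n \<Longrightarrow> x i = y i) \<Longrightarrow> form n M x x = form n M y y"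
      by (simp add: dot_def app_def)
  qed
  then obtain x where x: "dot n x x = 1" "dot n c x = 0"
    "\<And>y. dot n y y = 1 \<Longrightarrow> dot n c y = 0 \<Longrightarrow> form n M y y \<le> form n M x x" by blast
  define e where "e = form n M x x"
  have le: "form n M y y \<le> e * dot n y y" if "dot n c y = 0" for y
  proof (cases "dot n y y = 0")
    case True
    then have "form n M y y = 0" using pos by blast
    then show ?thesis using True by simp
  next
    case False
    then have "0 < dot n y y" using dot_nonneg[of y] by simp
    then show ?thesis using x(3)[of "nrm y"] nrm[OF False] that by (simp add: e_def pos_divide_le_eq)
  qed
  have e: "0 < e"
    using le[OF z(1)] z(2) dot_nonneg[of z] by (metis less_le_trans linorder_not_le mult_nonpos_nonneg)
  define y where "y = (\<lambda>i. app n M x i + (- e) * x i)"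
  have cy: "dot n c y = 0" unfolding y_def dot_add_scale_right using inv x by simp
  \<comment> \<open>First variation at the maximizer in direction of the residual \<open>y\<close>.
    The constant term is 0, so the linear coefficient vanishes, which says that \<open>y\<close> is
    orthogonal to itself.\<close>
  have "0 \<le> 0 + 2 * s * (e * dot n x y - form n M x y) + s\<^sup>2 * (e * dot n y y - form n M y y)" for s
  proof -
    have "dot n c (\<lambda>i. x i + s * y i) = 0" unfolding dot_add_scale_right using x cy by simp
    from le[OF this]
    have "form n M x x + 2 * s * form n M x y + s\<^sup>2 * form n M y y
        \<le> e * (dot n x x + 2 * s * dot n x y + s\<^sup>2 * dot n y y)"
      unfolding app_add_scale dot_add_scale_left dot_add_scale_right
      using form_commute[where x=x and y=y, OF sym]
      by (simp add: dot_commute[of n y x] power2_eq_square algebra_simps)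
    then show ?thesis using x(1) by (simp add: e_def algebra_simps)
  qed
  from quadratic_nonneg_discriminant[OF this] have "form n M x y = e * dot n x y" by simp
  then have "dot n y (app n M x) - e * dot n y x = 0"
    using form_commute[where x=x and y=y, OF sym] by (simp add: dot_commute)
  then have "dot n y (\<lambda>i. app n M x i + (- e) * x i) = 0"
    unfolding dot_add_scale_right by simp
  then have "dot n y y = 0" unfolding y_def .
  then have "app n M x i = e * x i" if "i < n" for i using dot_0[OF _ that, of y] by (simp add: y_def)
  then show ?thesis using e x le by blast
qed

text \<open>The derivative of the characteristic polynomial is a sum over the matrices with row and column \<open>i\<close>
  erased, and an eigenvector vanishing at \<open>i\<close> survives the erasure.\<close>

lemma double_eigenvalue_order:
  fixes G :: "real mat"
  assumes G: "G \<in> carrier_mat n n" and e: "e \<noteq> 0"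
    and double: "\<And>i. i < n \<Longrightarrow> \<exists>w \<in> carrier_vec n. w \<noteq> 0\<^sub>v n \<and> w $ i = 0 \<and> G *\<^sub>v w = e \<cdot>\<^sub>v w"
    and n: "n \<noteq> 0"
  shows "2 \<le> Polynomial.order e (char_poly G)"
proof -
  have nz: "char_poly G \<noteq> 0" using degree_monic_char_poly[OF G] by auto
  have "poly (char_poly (mat_erase G i i)) e = 0" if i: "i < n" for i
  proof -
    obtain w where w: "w \<in> carrier_vec n" "w \<noteq> 0\<^sub>v n" "w $ i = 0" "G *\<^sub>v w = e \<cdot>\<^sub>v w"
      using double[OF i] by blast
    have E: "mat_erase G i i \<in> carrier_mat n n" using G by (simp add: mat_erase_def)
    have "(mat_erase G i i *\<^sub>v w) $ j = e * w $ j" if j: "j < n" for j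
    proof (cases "j = i")
      case True
      then show ?thesis using G w i by (simp add: mat_erase_def scalar_prod_def)
    next
      case False
      have "(mat_erase G i i *\<^sub>v w) $ j = (G *\<^sub>v w) $ j"
        using G w(1,3) i j False by (auto simp: mat_erase_def scalar_prod_def intro!: sum.cong)
      then show ?thesis using w j by simp
    qed
    then have "mat_erase G i i *\<^sub>v w = e \<cdot>\<^sub>v w" using E w by (intro eq_vecI) auto
    then have "eigenvalue (mat_erase G i i) e"
      unfolding eigenvalue_def eigenvector_def using w E by auto
    then show ?thesis using eigenvalue_root_char_poly[OF E] by simp
  qed
  \<comment> \<open>Erased rows and columns are set to zero, not deleted, so the derivative comes
    with an extra factor \<open>X\<close>; it is cancelled because
    \<open>e \<noteq> 0\<close>.\<close>
  then have "poly (monom 1 1 * pderiv (char_poly G)) e = 0"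
    unfolding pderiv_char_poly_mat_erase[OF G] by (simp add: poly_sum)
  then have "poly (pderiv (char_poly G)) e = 0" using e by (simp add: poly_monom)
  moreover have "poly (char_poly G) e = 0"
  proof -
    obtain w where "w \<in> carrier_vec n" "w \<noteq> 0\<^sub>v n" "G *\<^sub>v w = e \<cdot>\<^sub>v w" using double[of 0] n by blast
    then have "eigenvalue G e" unfolding eigenvalue_def eigenvector_def using G by auto
    then show ?thesis using eigenvalue_root_char_poly[OF G] by simp
  qed
  moreover have "pderiv (char_poly G) \<noteq> 0"
    using degree_monic_char_poly[OF G] n by (metis pderiv_eq_0_iff)
  ultimately show ?thesis
    using order_pderiv[of "char_poly G" e] order_root[of "pderiv (char_poly G)" e] order_root[of "char_poly G" e] nz
    by (metis One_nat_def Suc_leI Suc_le_mono neq0_conv numeral_2_eq_2)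
qed

text \<open>Let \<open>u\<close> be a unit eigenvector for the largest eigenvalue
  \<open>e > 0\<close>. On its orthogonal complement the form is nonpositive, since otherwise a
  second positive eigenvector would raise the total multiplicity to 2. Hence
  \<open>r = sqrt e * u\<close> works; without positive values of the form, \<open>r = 0\<close>
  does.\<close>

lemma antiferromagnetic_form_le_square:
  fixes g :: "nat \<Rightarrow> nat \<Rightarrow> real"
  assumes G: "G \<in> carrier_mat n n" and sym: "\<And>i j. i < n \<Longrightarrow> j < n \<Longrightarrow> g i j = g j i"
    and g: "\<And>i j. i < n \<Longrightarrow> j < n \<Longrightarrow> g i j = G $$ (i,j)"
    and anti: "antiferromagnetic G"
  shows "\<exists>r. \<forall>y. form n g y y \<le> (dot n r y)\<^sup>2"
proof (cases "\<exists>z. 0 < form n g z z")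
  case False
  then have "form n g y y \<le> (dot n (\<lambda>_. 0) y)\<^sup>2" for y
    by (simp add: not_less dot_def)
  then show ?thesis by blast
next
  case True
  then obtain z where z: "0 < form n g z z" by blast
  have n: "n \<noteq> 0" using z by (intro notI) (simp add: dot_def)
  have Gv: "(G *\<^sub>v vec n x) $ i = app n g x i" if "i < n" for x i
    using that G by (simp add: app_def scalar_prod_def atLeast0LessThan g)
  have eig: "G *\<^sub>v vec n x = e \<cdot>\<^sub>v vec n x" if "\<forall>i<n. app n g x i = e * x i" for x e
    using that G Gv by (intro eq_vecI) auto
  have nonzero: "vec n x \<noteq> 0\<^sub>v n" if "dot n x x = 1" for x
  proof
    assume "vec n x = 0\<^sub>v n"
    then have "x i = 0" if "i < n" for i using that by (metis index_vec index_zero_vec(1))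
    then show False using that by (simp add: dot_def)
  qed
  have 0: "dot n (\<lambda>_. 0) y = 0" for y by (simp add: dot_def)
  obtain u e where u: "0 < e" "dot n u u = 1" "\<forall>i<n. app n g u i = e * u i"
    "\<And>y. form n g y y \<le> e * dot n y y"
    using positive_eigenvector_in_hyperplane[of n g "\<lambda>_. 0" z] sym 0 z by auto
  have gu: "form n g u y = e * dot n u y" for y
  proof -
    have "form n g u y = form n g y u" by (rule form_commute[OF sym])
    then show ?thesis using u(3) by (simp add: dot_def sum_distrib_left mult_ac)
  qed
  have orth: "form n g y y \<le> 0" if uy: "dot n u y = 0" for y
  proof (rule ccontr)
    assume "\<not> form n g y y \<le> 0"
    then obtain v f where v: "0 < f" "dot n v v = 1" "dot n u v = 0" "\<forall>i<n. app n g v i = f * v i"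
      using positive_eigenvector_in_hyperplane[of n g u y] sym gu uy by auto
    have eigI: "eigenvalue G c" if "dot n x x = 1" "\<forall>i<n. app n g x i = c * x i" for x c
      unfolding eigenvalue_def eigenvector_def
      using eig[OF that(2)] nonzero[OF that(1)] G by (intro exI[of _ "vec n x"]) simp
    have ev: "eigenvalue G e" "eigenvalue G f"
      using eigI[OF u(2,3)] eigI[OF v(2,4)] .
    have nz: "char_poly G \<noteq> 0" using degree_monic_char_poly[OF G] by auto
    define E where "E = {e. eigenvalue G e \<and> e > 0}"
    have fin: "finite E"
      using poly_roots_finite[OF nz] unfolding E_def eigenvalue_root_char_poly[OF G] by simp
    have ord: "(\<Sum>e\<in>E. Polynomial.order e (char_poly G)) \<le> 1"
      using anti unfolding antiferromagnetic_def E_def .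
    have "e \<in> E" "f \<in> E" using u v ev by (auto simp: E_def)
    have "1 \<le> Polynomial.order e (char_poly G)" "1 \<le> Polynomial.order f (char_poly G)"
      using ev nz order_root[of "char_poly G"] unfolding eigenvalue_root_char_poly[OF G]
      by (auto simp: Suc_le_eq)
    have "e = f"
    proof (rule ccontr)
      assume "e \<noteq> f"
      have "(\<Sum>e\<in>{e, f}. Polynomial.order e (char_poly G)) \<le> (\<Sum>e\<in>E. Polynomial.order e (char_poly G))"
        using fin \<open>e \<in> E\<close> \<open>f \<in> E\<close> by (intro sum_mono2) auto
      then show False using ord \<open>e \<noteq> f\<close> \<open>1 \<le> Polynomial.order e (char_poly G)\<close>
          \<open>1 \<le> Polynomial.order f (char_poly G)\<close> by simp
    qed
    have "2 \<le> Polynomial.order e (char_poly G)"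
    proof (rule double_eigenvalue_order[OF G _ _ n])
      fix i assume i: "i < n"
      \<comment> \<open>A nonzero vector in the span of \<open>u\<close> and \<open>v\<close> that
        vanishes at \<open>i\<close>. In the second case its product with \<open>v\<close> is 1, so
        it cannot be 0.\<close>
      define w where "w = (if u i = 0 then u else (\<lambda>j. v j + (- (v i / u i)) * u j))"
      have wi: "w i = 0" by (simp add: w_def)
      have "vec n w \<noteq> 0\<^sub>v n"
      proof (cases "u i = 0")
        case True
        then show ?thesis using nonzero[OF u(2)] by (simp add: w_def)
      next
        case False
        show ?thesis
        proof
          assume "vec n w = 0\<^sub>v n"
          then have "w j = 0" if "j < n" for j using that by (metis index_vec index_zero_vec(1))
          then have "dot n v w = 0" by (simp add: dot_def)
          then have "dot n v (\<lambda>j. v j + (- (v i / u i)) * u j) = 0" using False by (simp add: w_def)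
          then show False unfolding dot_add_scale_right using v(2,3) by (simp add: dot_commute)
        qed
      qed
      moreover have "\<forall>j<n. app n g w j = e * w j"
      proof (cases "u i = 0")
        case True
        then show ?thesis using u(3) by (simp add: w_def)
      next
        case False
        have "app n g (\<lambda>j. v j + (- (v i / u i)) * u j) j = e * (v j + (- (v i / u i)) * u j)" if "j < n" for j
          unfolding app_add_scale using u(3) v(4) that \<open>e = f\<close> by (simp add: algebra_simps)
        then show ?thesis using False by (simp add: w_def)
      qed
      ultimately show "\<exists>w \<in> carrier_vec n. w \<noteq> 0\<^sub>v n \<and> w $ i = 0 \<and> G *\<^sub>v w = e \<cdot>\<^sub>v w"
        using eig[of w e] wi i by (intro bexI[of _ "vec n w"]) auto
    qed (use u in auto)
    also have "\<dots> \<le> (\<Sum>e\<in>E. Polynomial.order e (char_poly G))"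
      using fin \<open>e \<in> E\<close> by (intro member_le_sum) auto
    finally show False using ord by simp
  qed
  have "form n g y y \<le> (dot n (\<lambda>i. 0 + sqrt e * u i) y)\<^sup>2" for y
  proof -
    \<comment> \<open>Subtracts from \<open>y\<close> its component along \<open>u\<close>.\<close>
    define s where "s = - dot n u y"
    have "dot n u (\<lambda>i. y i + s * u i) = 0" unfolding dot_add_scale_right by (simp add: s_def u)
    then have "form n g (\<lambda>i. y i + s * u i) (\<lambda>i. y i + s * u i) \<le> 0" by (rule orth)
    then have "form n g y y + 2 * s * form n g y u + s\<^sup>2 * form n g u u \<le> 0"
      using form_add_scale[where x = y and y = u and s = s, OF sym] by simp
    moreover have "form n g y u = e * dot n u y" using gu form_commute[of n g u y] sym by simp
    moreover have "form n g u u = e" using gu u by simp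
    ultimately have "form n g y y \<le> e * (dot n u y)\<^sup>2"
      by (simp add: s_def power2_eq_square algebra_simps)
    then show ?thesis unfolding dot_add_scale_left 0 using u by (simp add: power_mult_distrib)
  qed
  then show ?thesis by blast
qed

text \<open>The perturbation argument needs a nonnegative \<open>r\<close>. Reverse Cauchy-Schwarz
  against the all-ones vector gives the normalized row sums of \<open>M\<close>; if their total is
  0, then \<open>M\<close> vanishes.\<close>

lemma form_le_square_nonneg:
  assumes sym: "\<And>i j. i < n \<Longrightarrow> j < n \<Longrightarrow> M i j = M j i"
    and nonneg: "\<And>i j. i < n \<Longrightarrow> j < n \<Longrightarrow> 0 \<le> M i j"
    and RCS: "\<And>x y. 0 < form n M x x \<Longrightarrow> form n M y y * form n M x x \<le> (form n M x y)\<^sup>2"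
  shows "\<exists>r. (\<forall>i<n. 0 \<le> r i) \<and> (\<forall>y. form n M y y \<le> (dot n r y)\<^sup>2)"
proof (cases "0 < form n M (\<lambda>_. 1) (\<lambda>_. 1)")
  case True
  define c where "c = form n M (\<lambda>_. 1) (\<lambda>_. 1)"
  define r where "r i = 0 + (1 / sqrt c) * app n M (\<lambda>_. 1) i" for i
  have "0 \<le> r i" if "i < n" for i
    using that True nonneg by (auto simp: r_def c_def app_def intro!: sum_nonneg divide_nonneg_nonneg)
  moreover have "form n M y y \<le> (dot n r y)\<^sup>2" for y
  proof -
    have "dot n r y = form n M (\<lambda>_. 1) y / sqrt c"
    proof -
      have "dot n r y = dot n (\<lambda>_. 0) y + (1 / sqrt c) * dot n (app n M (\<lambda>_. 1)) y"
        unfolding r_def by (rule dot_add_scale_left)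
      moreover have "dot n (app n M (\<lambda>_. 1)) y = form n M (\<lambda>_. 1) y"
        by (subst dot_commute) (rule form_commute[OF sym])
      ultimately show ?thesis by (simp add: dot_def[of n "\<lambda>_. 0"])
    qed
    moreover have "form n M y y \<le> (form n M (\<lambda>_. 1) y)\<^sup>2 / c"
      using RCS[OF True, of y] True by (simp add: c_def pos_le_divide_eq)
    ultimately show ?thesis using True by (simp add: c_def power_divide)
  qed
  ultimately show ?thesis by blast
next
  case False
  have "M i j = 0" if "i < n" "j < n" for i j
  proof -
    have "(\<Sum>i<n. \<Sum>j<n. M i j) = 0"
      using False nonneg by (intro antisym) (auto simp: form_alt intro!: sum_nonneg)
    then have "(\<Sum>j<n. M i j) = 0"
      using that nonneg by (subst (asm) sum_nonneg_eq_0_iff) (auto intro!: sum_nonneg)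
    then show ?thesis using that nonneg by (subst (asm) sum_nonneg_eq_0_iff) auto
  qed
  then have "form n M y y \<le> (dot n (\<lambda>_. 0) y)\<^sup>2" for y by (simp add: form_alt)
  then show ?thesis by (intro exI[of _ "\<lambda>_. 0"]) auto
qed

section \<open>Comparison with homomorphism sums\<close>

lemma sum_PiE_Suc:
  fixes f :: "(nat \<Rightarrow> nat) \<Rightarrow> real"
  shows "(\<Sum>\<phi>\<in>{0..<Suc t} \<rightarrow>\<^sub>E S. f \<phi>) = (\<Sum>k\<in>S. \<Sum>\<phi>\<in>{0..<t} \<rightarrow>\<^sub>E S. f (\<phi>(t := k)))"
proof -
  have "(\<Sum>\<phi>\<in>{0..<Suc t} \<rightarrow>\<^sub>E S. f \<phi>) = (\<Sum>(k, \<phi>)\<in>S \<times> ({0..<t} \<rightarrow>\<^sub>E S). f (\<phi>(t := k)))"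
    unfolding atLeast0_lessThan_Suc PiE_insert_eq
    by (subst sum.reindex) (auto intro!: inj_combinator simp: case_prod_beta)
  then show ?thesis by (simp add: sum.cartesian_product)
qed

lemma prod_lessThan_Suc_pairs:
  fixes f :: "nat \<Rightarrow> nat \<Rightarrow> real"
  shows "(\<Prod>i\<in>{0..<Suc t}. \<Prod>j\<in>{0..<Suc t}. f i j) =
    (\<Prod>i\<in>{0..<t}. \<Prod>j\<in>{0..<t}. f i j) * (\<Prod>i\<in>{0..<t}. f i t) * (\<Prod>j\<in>{0..<t}. f t j) * f t t"
  by (simp add: atLeast0_lessThan_Suc prod.distrib mult_ac)

lemma V_Kt_eq_clique_vol:
  assumes g: "\<And>i j. i < n \<Longrightarrow> j < n \<Longrightarrow> g i j = G $$ (i,j)"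
    and sym: "\<And>i j. g i j = g j i"
  shows "V_Kt n G t x = clique_vol n g t x"
proof (induction t arbitrary: x)
  case 0
  show ?case by (simp add: V_Kt_def)
next
  case (Suc t)
  have "V_Kt n G (Suc t) x = (\<Sum>k\<in>{0..<n}. \<Sum>\<phi>\<in>{0..<t} \<rightarrow>\<^sub>E {0..<n}. x k *
    ((\<Prod>i\<in>{0..<t}. \<Prod>j\<in>{0..<t}. if i < j then G $$ (\<phi> i, \<phi> j) else 1) *
      (\<Prod>s\<in>{0..<t}. g k (\<phi> s) * x (\<phi> s))))"
    unfolding V_Kt_def sum_PiE_Suc
  proof (intro sum.cong refl)
    fix k \<phi> assume k: "k \<in> {0..<n}" and \<phi>: "\<phi> \<in> {0..<t} \<rightarrow>\<^sub>E {0..<n}"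
    let ?\<psi> = "\<phi>(t := k)"
    have "(\<Prod>i\<in>{0..<Suc t}. \<Prod>j\<in>{0..<Suc t}. if i < j then G $$ (?\<psi> i, ?\<psi> j) else 1) =
      (\<Prod>i\<in>{0..<t}. \<Prod>j\<in>{0..<t}. if i < j then G $$ (\<phi> i, \<phi> j) else 1) * (\<Prod>i\<in>{0..<t}. G $$ (\<phi> i, k))"
      unfolding prod_lessThan_Suc_pairs by (auto intro!: arg_cong2[of _ _ _ _ "(*)"] prod.cong)
    also have "(\<Prod>i\<in>{0..<t}. G $$ (\<phi> i, k)) = (\<Prod>i\<in>{0..<t}. g k (\<phi> i))"
      using k \<phi> by (intro prod.cong refl) (metis PiE_mem atLeastLessThan_iff g sym)
    finally have "(\<Prod>i\<in>{0..<Suc t}. \<Prod>j\<in>{0..<Suc t}. if i < j then G $$ (?\<psi> i, ?\<psi> j) else 1) =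
      (\<Prod>i\<in>{0..<t}. \<Prod>j\<in>{0..<t}. if i < j then G $$ (\<phi> i, \<phi> j) else 1) * (\<Prod>i\<in>{0..<t}. g k (\<phi> i))" .
    moreover have "(\<Prod>s\<in>{0..<Suc t}. x (?\<psi> s)) = x k * (\<Prod>s\<in>{0..<t}. x (\<phi> s))"
      by (simp add: atLeast0_lessThan_Suc)
    ultimately show "(\<Prod>i\<in>{0..<Suc t}. \<Prod>j\<in>{0..<Suc t}. if i < j then G $$ (?\<psi> i, ?\<psi> j) else 1) *
      (\<Prod>s\<in>{0..<Suc t}. x (?\<psi> s)) = x k *
      ((\<Prod>i\<in>{0..<t}. \<Prod>j\<in>{0..<t}. if i < j then G $$ (\<phi> i, \<phi> j) else 1) *
      (\<Prod>s\<in>{0..<t}. g k (\<phi> s) * x (\<phi> s)))"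
      by (simp only: prod.distrib mult_ac)
  qed
  also have "\<dots> = (\<Sum>k<n. x k * V_Kt n G t (\<lambda>i. g k i * x i))"
    by (simp add: V_Kt_def sum_distrib_left atLeast0LessThan)
  finally show ?case by (simp add: Suc)
qed

text \<open>A map on the tensor product is the pair of its restrictions to the two layers; separate
  sums allow one vertex to be removed from each.\<close>

lemma V_KtK2_eq_sum_pairs:
  "V_KtK2 n G t a b = (\<Sum>\<alpha>\<in>{0..<t} \<rightarrow>\<^sub>E {0..<n}. \<Sum>\<beta>\<in>{0..<t} \<rightarrow>\<^sub>E {0..<n}.
      (\<Prod>i\<in>{0..<t}. \<Prod>j\<in>{0..<t}. if i \<noteq> j then G $$ (\<alpha> i, \<beta> j) else 1) *
      (\<Prod>i\<in>{0..<t}. a (\<alpha> i) * b (\<beta> i)))"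
proof -
  let ?T = "{0..<t}" and ?N = "{0..<n}"
  have "V_KtK2 n G t a b = (\<Sum>(\<alpha>, \<beta>)\<in>(?T \<rightarrow>\<^sub>E ?N) \<times> (?T \<rightarrow>\<^sub>E ?N).
      (\<Prod>i\<in>?T. \<Prod>j\<in>?T. if i \<noteq> j then G $$ (\<alpha> i, \<beta> j) else 1) * (\<Prod>i\<in>?T. a (\<alpha> i) * b (\<beta> i)))"
    unfolding V_KtK2_def
  proof (rule sum.reindex_bij_witness
      [where j = "\<lambda>\<phi>. (\<lambda>i\<in>?T. \<phi> (i, 1), \<lambda>i\<in>?T. \<phi> (i, 2))"
        and i = "\<lambda>(\<alpha>, \<beta>). \<lambda>p\<in>?T \<times> {1, 2}. if snd p = 1 then \<alpha> (fst p) else \<beta> (fst p)"])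
    fix \<phi> assume \<phi>: "\<phi> \<in> ?T \<times> {1::nat, 2} \<rightarrow>\<^sub>E ?N"
    show "(case (\<lambda>i\<in>?T. \<phi> (i, 1), \<lambda>i\<in>?T. \<phi> (i, 2)) of (\<alpha>, \<beta>) \<Rightarrow>
        \<lambda>p\<in>?T \<times> {1, 2}. if snd p = 1 then \<alpha> (fst p) else \<beta> (fst p)) = \<phi>"
    proof
      fix p :: "nat \<times> nat"
      show "(case (\<lambda>i\<in>?T. \<phi> (i, 1), \<lambda>i\<in>?T. \<phi> (i, 2)) of (\<alpha>, \<beta>) \<Rightarrow>
        \<lambda>p\<in>?T \<times> {1, 2}. if snd p = 1 then \<alpha> (fst p) else \<beta> (fst p)) p = \<phi> p"
        using PiE_arb[OF \<phi>, of p] by (cases p) (auto simp: restrict_def)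
    qed
    show "(\<lambda>i\<in>?T. \<phi> (i, 1), \<lambda>i\<in>?T. \<phi> (i, 2)) \<in> (?T \<rightarrow>\<^sub>E ?N) \<times> (?T \<rightarrow>\<^sub>E ?N)"
      using PiE_mem[OF \<phi>] by auto
    show "(case (\<lambda>i\<in>?T. \<phi> (i, 1), \<lambda>i\<in>?T. \<phi> (i, 2)) of (\<alpha>, \<beta>) \<Rightarrow>
        (\<Prod>i\<in>?T. \<Prod>j\<in>?T. if i \<noteq> j then G $$ (\<alpha> i, \<beta> j) else 1) * (\<Prod>i\<in>?T. a (\<alpha> i) * b (\<beta> i)))
      = (\<Prod>i\<in>?T. \<Prod>j\<in>?T. if i \<noteq> j then G $$ (\<phi> (i, 1), \<phi> (j, 2)) else 1) *
        (\<Prod>i\<in>?T. a (\<phi> (i, 1)) * b (\<phi> (i, 2)))"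
      by (auto intro!: arg_cong2[of _ _ _ _ "(*)"] prod.cong)
  next
    fix p :: "(nat \<Rightarrow> nat) \<times> (nat \<Rightarrow> nat)" assume "p \<in> (?T \<rightarrow>\<^sub>E ?N) \<times> (?T \<rightarrow>\<^sub>E ?N)"
    then obtain \<alpha> \<beta> where p: "p = (\<alpha>, \<beta>)" "\<alpha> \<in> ?T \<rightarrow>\<^sub>E ?N" "\<beta> \<in> ?T \<rightarrow>\<^sub>E ?N" by auto
    let ?q = "case p of (\<alpha>, \<beta>) \<Rightarrow> \<lambda>p\<in>?T \<times> {1::nat, 2}. if snd p = 1 then \<alpha> (fst p) else \<beta> (fst p)"
    show "(\<lambda>i\<in>?T. ?q (i, 1), \<lambda>i\<in>?T. ?q (i, 2)) = p"
      using PiE_arb[OF p(2)] PiE_arb[OF p(3)] by (auto simp: p(1) restrict_def fun_eq_iff)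
    show "?q \<in> ?T \<times> {1, 2} \<rightarrow>\<^sub>E ?N"
      using PiE_mem[OF p(2)] PiE_mem[OF p(3)] by (auto simp: p(1))
  qed
  then show ?thesis by (simp add: sum.cartesian_product)
qed

lemma V_KtK2_eq_double_vol:
  assumes g: "\<And>i j. i < n \<Longrightarrow> j < n \<Longrightarrow> g i j = G $$ (i,j)"
    and sym: "\<And>i j. g i j = g j i"
  shows "V_KtK2 n G t a b = double_vol n g t a b"
proof (induction t arbitrary: a b)
  case 0
  show ?case by (simp add: V_KtK2_eq_sum_pairs)
next
  case (Suc t)
  let ?T = "{0..<t}" and ?N = "{0..<n}"
  have "V_KtK2 n G (Suc t) a b = (\<Sum>k\<in>?N. \<Sum>\<alpha>\<in>?T \<rightarrow>\<^sub>E ?N. \<Sum>l\<in>?N. \<Sum>\<beta>\<in>?T \<rightarrow>\<^sub>E ?N. a k * b l *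
    ((\<Prod>i\<in>?T. \<Prod>j\<in>?T. if i \<noteq> j then G $$ (\<alpha> i, \<beta> j) else 1) *
      (\<Prod>i\<in>?T. (g l (\<alpha> i) * a (\<alpha> i)) * (g k (\<beta> i) * b (\<beta> i)))))"
    unfolding V_KtK2_eq_sum_pairs sum_PiE_Suc
  proof (intro sum.cong refl)
    fix k l \<alpha> \<beta> assume k: "k \<in> ?N" and l: "l \<in> ?N"
      and \<alpha>: "\<alpha> \<in> ?T \<rightarrow>\<^sub>E ?N" and \<beta>: "\<beta> \<in> ?T \<rightarrow>\<^sub>E ?N"
    let ?\<alpha> = "\<alpha>(t := k)" and ?\<beta> = "\<beta>(t := l)"
    \<comment> \<open>The two removed vertices are not adjacent, so no factor
      \<open>G $$ (k, l)\<close> appears; each is joined to the opposite layer, hence the crossed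
      rows \<open>g l\<close> and \<open>g k\<close>.\<close>
    have "(\<Prod>i\<in>{0..<Suc t}. \<Prod>j\<in>{0..<Suc t}. if i \<noteq> j then G $$ (?\<alpha> i, ?\<beta> j) else 1) =
      (\<Prod>i\<in>?T. \<Prod>j\<in>?T. if i \<noteq> j then G $$ (\<alpha> i, \<beta> j) else 1) *
      (\<Prod>i\<in>?T. G $$ (\<alpha> i, l)) * (\<Prod>j\<in>?T. G $$ (k, \<beta> j))"
      unfolding prod_lessThan_Suc_pairs by (auto intro!: arg_cong2[of _ _ _ _ "(*)"] prod.cong)
    also have "(\<Prod>i\<in>?T. G $$ (\<alpha> i, l)) = (\<Prod>i\<in>?T. g l (\<alpha> i))"
      using l \<alpha> by (intro prod.cong refl) (metis PiE_mem atLeastLessThan_iff g sym)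
    also have "(\<Prod>j\<in>?T. G $$ (k, \<beta> j)) = (\<Prod>j\<in>?T. g k (\<beta> j))"
      using k \<beta> by (intro prod.cong refl) (metis PiE_mem atLeastLessThan_iff g)
    finally have "(\<Prod>i\<in>{0..<Suc t}. \<Prod>j\<in>{0..<Suc t}. if i \<noteq> j then G $$ (?\<alpha> i, ?\<beta> j) else 1) =
      (\<Prod>i\<in>?T. \<Prod>j\<in>?T. if i \<noteq> j then G $$ (\<alpha> i, \<beta> j) else 1) *
      (\<Prod>i\<in>?T. g l (\<alpha> i)) * (\<Prod>j\<in>?T. g k (\<beta> j))" .
    moreover have "(\<Prod>i\<in>{0..<Suc t}. a (?\<alpha> i) * b (?\<beta> i)) = a k * b l * (\<Prod>i\<in>?T. a (\<alpha> i) * b (\<beta> i))"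
      by (simp add: atLeast0_lessThan_Suc)
    ultimately show "(\<Prod>i\<in>{0..<Suc t}. \<Prod>j\<in>{0..<Suc t}. if i \<noteq> j then G $$ (?\<alpha> i, ?\<beta> j) else 1) *
      (\<Prod>i\<in>{0..<Suc t}. a (?\<alpha> i) * b (?\<beta> i)) = a k * b l *
      ((\<Prod>i\<in>?T. \<Prod>j\<in>?T. if i \<noteq> j then G $$ (\<alpha> i, \<beta> j) else 1) *
      (\<Prod>i\<in>?T. (g l (\<alpha> i) * a (\<alpha> i)) * (g k (\<beta> i) * b (\<beta> i))))"
      by (simp only: prod.distrib mult_ac)
  qed
  also have "\<dots> = (\<Sum>k\<in>?N. \<Sum>l\<in>?N. \<Sum>\<alpha>\<in>?T \<rightarrow>\<^sub>E ?N. \<Sum>\<beta>\<in>?T \<rightarrow>\<^sub>E ?N. a k * b l *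
    ((\<Prod>i\<in>?T. \<Prod>j\<in>?T. if i \<noteq> j then G $$ (\<alpha> i, \<beta> j) else 1) *
      (\<Prod>i\<in>?T. (g l (\<alpha> i) * a (\<alpha> i)) * (g k (\<beta> i) * b (\<beta> i)))))"
    by (intro sum.cong refl sum.swap)
  also have "\<dots> = (\<Sum>k<n. \<Sum>l<n. a k * b l * V_KtK2 n G t (\<lambda>i. g l i * a i) (\<lambda>i. g k i * b i))"
    by (simp add: V_KtK2_eq_sum_pairs sum_distrib_left atLeast0LessThan)
  finally show ?case by (simp add: Suc)
qed

theorem theorem4p3:
  fixes n t :: nat and G :: "real mat" and a b :: "nat \<Rightarrow> real"
  assumes "weighted_graph n G" and "antiferromagnetic G" and "t \<ge> 2"
    and "\<forall>i<n. a i \<ge> 0" and "\<forall>i<n. b i \<ge> 0"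
  shows "V_Kt n G t a * V_Kt n G t b \<le> V_KtK2 n G t a b"
proof -
  \<comment> \<open>Extending \<open>G\<close> by 0 makes symmetry hold for all indices, as the
    volume lemmas require.\<close>
  define g where "g i j = (if i < n \<and> j < n then G $$ (i,j) else 0)" for i j
  have G: "G \<in> carrier_mat n n" "G\<^sup>T = G" "\<And>i j. i < n \<Longrightarrow> j < n \<Longrightarrow> 0 \<le> G $$ (i,j)"
    using assms(1) by (auto simp: weighted_graph_def)
  have gG: "g i j = G $$ (i,j)" if "i < n" "j < n" for i j using that by (simp add: g_def)
  have sym: "g i j = g j i" for i j
    using G(1,2) by (auto simp: g_def) (metis carrier_matD index_transpose_mat(1))
  have nonneg: "0 \<le> g i j" for i j using G(3) by (simp add: g_def)
  obtain r where r: "\<And>y. form n g y y \<le> (dot n r y)\<^sup>2"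
    using antiferromagnetic_form_le_square[OF G(1) sym gG assms(2)] by blast
  \<comment> \<open>The vector \<open>r\<close> may have negative entries; it only serves to prove
    reverse Cauchy-Schwarz, which then yields a nonnegative one.\<close>
  obtain r' where "\<forall>i<n. 0 \<le> r' i" "\<And>y. form n g y y \<le> (dot n r' y)\<^sup>2"
    using form_le_square_nonneg[of n g] sym nonneg form_reverse_Cauchy_Schwarz[of n g r] r by blast
  then show ?thesis
    using clique_vol_mult_le_double_vol[of g n r' a b t] sym nonneg assms(4,5)
    by (simp add: V_Kt_eq_clique_vol[OF gG sym] V_KtK2_eq_double_vol[OF gG sym])
qed

end
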